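(* There is an algorithm that decides, given $m\ge1$, an $m$-ary regular relation $R\in\mathsf{REG}_m$ over $\Sigma$ and a set $I\subseteq[m]^2$, whether $R\cap_I{\sqsubseteq}\neq\emptyset$, i.e. whether there is $(w_1,\dots,w_m)\in R$ with $w_i\sqsubseteq w_j$ for all $(i,j)\in I$. Consequently query evaluation for ECRPQ($\sqsubseteq$) queries is decidable.
   Context: $\Sigma$ finite alphabet; $u\sqsubseteq w$ iff $u$ is obtained from $w$ by deleting some (possibly no) letters. $[m]=\{1,\dots,m\}$. $\Sigma_\bot=\Sigma\cup\{\bot\}$, $\bot\notin\Sigma$; for $(w_1,\dots,w_m)\in(\Sigma^* )^m$, $w_1\otimes\cdots\otimes w_m$ is the word over $\Sigma_\bot^m$ of length $\max_i|w_i|$ whose $k$-th letter is the tuple of $k$-th letters of the $w_i$ (with $\bot$ when $|w_i|<k$). $R\in\mathsf{REG}_m$ if an NFA over $\Sigma_\bot^m$ accepts exactly $\{w_1\otimes\cdots\otimes w_m:(w_1,\dots,w_m)\in R\}$; $R$ is given by that NFA. $R\cap_I S$ is the set of tuples in $R$ whose $i$-th and $j$-th components are $S$-related for every $(i,j)\in I$. ECRPQ($S$) queries over $\Sigma$-labeled graphs are existentially quantified conjunctions of regular path atoms $u_i\xrightarrow{\chi_i:L_i}u_i'$, regular-relation atoms on path labels, and atoms $S(\chi_i,\chi_j)$; evaluation asks whether a given graph and node tuple satisfy a given query. *)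

theory Defs
  imports Main "HOL-Library.Nat_Bijection" "HOL-Library.Sublist"
begin

datatype recf = Zero | Succ | Proj nat | Comp recf "recf list" | PrimRec recf recf | Mu recf

inductive eval :: "recf \<Rightarrow> nat list \<Rightarrow> nat \<Rightarrow> bool" where
  eval_Zero: "eval Zero xs 0"
| eval_Succ: "eval Succ (x # xs) (Suc x)"
| eval_Proj: "i < length xs \<Longrightarrow> eval (Proj i) xs (xs ! i)"
| eval_Comp: "list_all2 (\<lambda>g y. eval g xs y) gs ys \<Longrightarrow> eval f ys r \<Longrightarrow> eval (Comp f gs) xs r"
| eval_Pr0: "eval f xs r \<Longrightarrow> eval (PrimRec f g) (0 # xs) r"
| eval_PrS: "eval (PrimRec f g) (y # xs) r' \<Longrightarrow> eval g (y # r' # xs) r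
             \<Longrightarrow> eval (PrimRec f g) (Suc y # xs) r"
| eval_Mu: "eval f (y # xs) 0 \<Longrightarrow> (\<forall>z<y. \<exists>v. v > 0 \<and> eval f (z # xs) v)
             \<Longrightarrow> eval (Mu f) xs y"

text \<open>The finite alphabet Sigma is {0..<k}; the padding symbol bot is None.\<close>

definition sigma_word :: "nat \<Rightarrow> nat list \<Rightarrow> bool" where
  "sigma_word k w \<longleftrightarrow> set w \<subseteq> {0..<k}"

definition conv :: "nat list list \<Rightarrow> nat option list list" where
  "conv ws = map (\<lambda>p. map (\<lambda>w. if p < length w then Some (w ! p) else None) ws)
                 [0..<foldr max (map length ws) 0]"

type_synonym 'a nfa = "nat list \<times> nat list \<times> (nat \<times> 'a \<times> nat) list"

definition nfa_init :: "'a nfa \<Rightarrow> nat list" where "nfa_init A = fst A"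
definition nfa_final :: "'a nfa \<Rightarrow> nat list" where "nfa_final A = fst (snd A)"
definition nfa_trans :: "'a nfa \<Rightarrow> (nat \<times> 'a \<times> nat) list" where "nfa_trans A = snd (snd A)"

inductive nfa_run :: "'a nfa \<Rightarrow> nat \<Rightarrow> 'a list \<Rightarrow> nat \<Rightarrow> bool" for A where
  "nfa_run A q [] q"
| "(q, a, q') \<in> set (nfa_trans A) \<Longrightarrow> nfa_run A q' w q'' \<Longrightarrow> nfa_run A q (a # w) q''"

definition nfa_lang :: "'a nfa \<Rightarrow> 'a list set" where
  "nfa_lang A = {w. \<exists>q0 qf. q0 \<in> set (nfa_init A) \<and> qf \<in> set (nfa_final A) \<and> nfa_run A q0 w qf}"

definition sigma_nfa :: "nat \<Rightarrow> nat nfa \<Rightarrow> bool" where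
  "sigma_nfa k A \<longleftrightarrow> (\<forall>(q, a, q') \<in> set (nfa_trans A). a < k)"

text \<open>NFA over (Sigma_bot)^m which accepts only convolutions of m-tuples of Sigma-words,
  i.e. a representation of an m-ary regular relation.\<close>
definition reg_nfa :: "nat \<Rightarrow> nat \<Rightarrow> nat option list nfa \<Rightarrow> bool" where
  "reg_nfa k m A \<longleftrightarrow>
     (\<forall>(q, a, q') \<in> set (nfa_trans A). length a = m \<and> (\<forall>x \<in> set a. x = None \<or> (\<exists>c<k. x = Some c)))
   \<and> (\<forall>w \<in> nfa_lang A. \<exists>ws. length ws = m \<and> (\<forall>v \<in> set ws. sigma_word k v) \<and> w = conv ws)"

definition rel_of :: "nat \<Rightarrow> nat \<Rightarrow> nat option list nfa \<Rightarrow> nat list list set" where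
  "rel_of k m A = {ws. length ws = m \<and> (\<forall>v \<in> set ws. sigma_word k v) \<and> conv ws \<in> nfa_lang A}"

text \<open>R cap_I subword is nonempty (indices in [m] are 1-based).\<close>
definition subword_inter_nonempty ::
  "nat \<Rightarrow> nat \<Rightarrow> nat option list nfa \<Rightarrow> (nat \<times> nat) list \<Rightarrow> bool" where
  "subword_inter_nonempty k m A I \<longleftrightarrow>
     (\<exists>ws \<in> rel_of k m A. \<forall>(i, j) \<in> set I. subseq (ws ! (i - 1)) (ws ! (j - 1)))"

text \<open>A Sigma-labelled graph: (number of nodes N, edges (u, a, v)); nodes are {0..<N}.\<close>
type_synonym graph = "nat \<times> (nat \<times> nat \<times> nat) list"

definition wf_graph :: "nat \<Rightarrow> graph \<Rightarrow> bool" where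
  "wf_graph k G \<longleftrightarrow> (\<forall>(u, a, v) \<in> set (snd G). u < fst G \<and> v < fst G \<and> a < k)"

inductive gpath :: "graph \<Rightarrow> nat \<Rightarrow> nat list \<Rightarrow> nat \<Rightarrow> bool" for G where
  "gpath G u [] u"
| "(u, a, v) \<in> set (snd G) \<Longrightarrow> gpath G v w v' \<Longrightarrow> gpath G u (a # w) v'"

text \<open>Query: number of node variables, free node variables, path atoms
  (x_i, L_i, y_i) (the i-th one introduces path variable chi_i),
  regular relation atoms (R, [chi indices]), subword atoms (i, j) meaning chi_i subword chi_j.\<close>
datatype ecrpq = ECRPQ
  (q_nvars: nat)
  (q_free: "nat list")
  (q_patoms: "(nat \<times> nat nfa \<times> nat) list")
  (q_ratoms: "(nat option list nfa \<times> nat list) list")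
  (q_satoms: "(nat \<times> nat) list")

definition wf_query :: "nat \<Rightarrow> ecrpq \<Rightarrow> bool" where
  "wf_query k Q \<longleftrightarrow>
     (\<forall>x \<in> set (q_free Q). x < q_nvars Q)
   \<and> (\<forall>(x, L, y) \<in> set (q_patoms Q). x < q_nvars Q \<and> y < q_nvars Q \<and> sigma_nfa k L)
   \<and> (\<forall>(R, js) \<in> set (q_ratoms Q). js \<noteq> [] \<and> (\<forall>j \<in> set js. j < length (q_patoms Q))
                                    \<and> reg_nfa k (length js) R)
   \<and> (\<forall>(i, j) \<in> set (q_satoms Q). i < length (q_patoms Q) \<and> j < length (q_patoms Q))"

definition query_holds :: "graph \<Rightarrow> nat list \<Rightarrow> ecrpq \<Rightarrow> bool" where
  "query_holds G vs Q \<longleftrightarrow>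
     (\<exists>\<nu> ws. (\<forall>x < q_nvars Q. \<nu> x < fst G)
        \<and> (\<forall>i < length (q_free Q). \<nu> (q_free Q ! i) = vs ! i)
        \<and> length ws = length (q_patoms Q)
        \<and> (\<forall>i < length (q_patoms Q). case q_patoms Q ! i of (x, L, y) \<Rightarrow>
              gpath G (\<nu> x) (ws ! i) (\<nu> y) \<and> ws ! i \<in> nfa_lang L)
        \<and> (\<forall>(R, js) \<in> set (q_ratoms Q). conv (map (\<lambda>j. ws ! j) js) \<in> nfa_lang R)
        \<and> (\<forall>(i, j) \<in> set (q_satoms Q). subseq (ws ! i) (ws ! j)))"

definition enc_opt :: "nat option \<Rightarrow> nat" where
  "enc_opt x = (case x of None \<Rightarrow> 0 | Some c \<Rightarrow> Suc c)"

definition enc_tuple_letter :: "nat option list \<Rightarrow> nat" where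
  "enc_tuple_letter a = list_encode (map enc_opt a)"

definition enc_nfa :: "('a \<Rightarrow> nat) \<Rightarrow> 'a nfa \<Rightarrow> nat" where
  "enc_nfa ea A = list_encode [list_encode (nfa_init A), list_encode (nfa_final A),
     list_encode (map (\<lambda>(q, a, q'). list_encode [q, ea a, q']) (nfa_trans A))]"

definition enc_instance :: "nat \<Rightarrow> nat option list nfa \<Rightarrow> (nat \<times> nat) list \<Rightarrow> nat" where
  "enc_instance m A I = list_encode [m, enc_nfa enc_tuple_letter A, list_encode (map prod_encode I)]"

definition enc_graph :: "graph \<Rightarrow> nat" where
  "enc_graph G = list_encode [fst G, list_encode (map (\<lambda>(u, a, v). list_encode [u, a, v]) (snd G))]"

definition enc_query :: "ecrpq \<Rightarrow> nat" where
  "enc_query Q = list_encode [q_nvars Q, list_encode (q_free Q),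
     list_encode (map (\<lambda>(x, L, y). list_encode [x, enc_nfa id L, y]) (q_patoms Q)),
     list_encode (map (\<lambda>(R, js). list_encode [enc_nfa enc_tuple_letter R, list_encode js]) (q_ratoms Q)),
     list_encode (map prod_encode (q_satoms Q))]"

definition enc_eval_instance :: "graph \<Rightarrow> nat list \<Rightarrow> ecrpq \<Rightarrow> nat" where
  "enc_eval_instance G vs Q = list_encode [enc_graph G, list_encode vs, enc_query Q]"

end

theory Submission
  imports Defs "HOL-Library.Infinite_Set"
begin

text \<open>Scan the words of a tuple synchronously from left to right and keep, for every constraint
  \<open>w\<^sub>i \<sqsubseteq> w\<^sub>j\<close>, a queue with the part of \<open>w\<^sub>i\<close> that is not yet matched in \<open>w\<^sub>j\<close>. Since the
  \<open>p\<close>-th letter of \<open>w\<^sub>i\<close> is matched at a position \<open>\<ge> p\<close>, greedy matching is complete: the constraints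
  hold iff all queues are empty at the end. Together with the states of the automata this is a
  transition system that is monotone for the subword order on queues, which is a well-quasi-order
  by Higman's lemma. So if no accepting configuration is reachable, then the reachable
  configurations have a finite basis, and that basis is a checkable certificate of emptiness;
  otherwise an accepted word is a certificate. Searching for both kinds of certificates in parallel
  decides the problem. A query reduces to finitely many such problems, one for each valuation of its
  node variables.\<close>

section \<open>Computable functions on coded data\<close>

text \<open>The subword relation is in general not a synchronous regular relation, so no product
  automaton settles the matter, and unbounded queues give infinitely many configurations. No bound
  on witnesses is derived: Higman's lemma only guarantees that a finite basis exists. The basis is
  never constructed but guessed and checked, and the check is local. Its upward closure contains the
  start and is closed under steps by monotonicity; acceptance asks for empty queues and so passes to
  smaller configurations, whence a basis without accepting members rules them out in the whole
  closure. The other obstacle is the concrete machine model \<open>recf\<close>. Every type involved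
  gets a bijective coding, so each number is a meaningful input and closure rules for total
  functions carry the construction without side conditions. In particular the two searches
  complement each other on arbitrary instances; well-formedness matters only when acceptance is
  translated back into relations and queries.\<close>

definition recursive :: "nat \<Rightarrow> (nat list \<Rightarrow> nat) \<Rightarrow> bool" where
  "recursive n F \<longleftrightarrow> (\<exists>r. \<forall>xs. length xs = n \<longrightarrow> eval r xs (F xs))"

lemma recursive_proj: "i < n \<Longrightarrow> recursive n (\<lambda>xs. xs ! i)"
  unfolding recursive_def by (metis eval_Proj)

lemma eval_Comp1: "eval g xs y \<Longrightarrow> eval f [y] r \<Longrightarrow> eval (Comp f [g]) xs r"
  by (rule eval_Comp[where ys = "[y]"]) auto

lemma eval_Comp2: "eval g xs y \<Longrightarrow> eval h xs z \<Longrightarrow> eval f [y, z] r \<Longrightarrow> eval (Comp f [g, h]) xs r"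
  by (rule eval_Comp[where ys = "[y, z]"]) auto

lemma recursive_comp1:
  assumes "recursive 1 (\<lambda>xs. f (xs ! 0))" "recursive n g"
  shows "recursive n (\<lambda>xs. f (g xs))"
proof -
  obtain rf where rf: "\<And>xs. length xs = 1 \<Longrightarrow> eval rf xs (f (xs ! 0))"
    using assms(1) unfolding recursive_def by blast
  obtain rg where rg: "\<And>xs. length xs = n \<Longrightarrow> eval rg xs (g xs)"
    using assms(2) unfolding recursive_def by blast
  show ?thesis unfolding recursive_def
    by (rule exI[of _ "Comp rf [rg]"]) (use rf[of "[_]"] rg in \<open>auto intro: eval_Comp1\<close>)
qed

lemma recursive_comp2:
  assumes "recursive 2 (\<lambda>xs. f (xs ! 0) (xs ! 1))" "recursive n g" "recursive n h"
  shows "recursive n (\<lambda>xs. f (g xs) (h xs))"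
proof -
  obtain rf where rf: "\<And>xs. length xs = 2 \<Longrightarrow> eval rf xs (f (xs ! 0) (xs ! 1))"
    using assms(1) unfolding recursive_def by blast
  obtain rg where rg: "\<And>xs. length xs = n \<Longrightarrow> eval rg xs (g xs)"
    using assms(2) unfolding recursive_def by blast
  obtain rh where rh: "\<And>xs. length xs = n \<Longrightarrow> eval rh xs (h xs)"
    using assms(3) unfolding recursive_def by blast
  show ?thesis unfolding recursive_def
    by (rule exI[of _ "Comp rf [rg, rh]"]) (use rf[of "[_, _]"] rg rh in \<open>fastforce intro: eval_Comp2\<close>)
qed

lemma recursive_Suc: "recursive n g \<Longrightarrow> recursive n (\<lambda>xs. Suc (g xs))"
proof (rule recursive_comp1[of Suc])
  show "recursive 1 (\<lambda>xs. Suc (xs ! 0))"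
    unfolding recursive_def
    by (rule exI[of _ Succ]) (auto simp: length_Suc_conv intro: eval_Succ)
qed

lemma recursive_const: "recursive n (\<lambda>_. c)"
proof (induct c)
  case 0
  show ?case unfolding recursive_def by (metis eval_Zero)
next
  case (Suc c)
  then show ?case by (rule recursive_Suc)
qed

lemma recursive_rec_nat:
  assumes "recursive n f" "recursive (n + 2) (\<lambda>ys. g (ys ! 0) (ys ! 1) (drop 2 ys))" "recursive n h"
  shows "recursive n (\<lambda>xs. rec_nat (f xs) (\<lambda>y r. g y r xs) (h xs))"
proof -
  obtain rf where rf: "\<And>xs. length xs = n \<Longrightarrow> eval rf xs (f xs)"
    using assms(1) unfolding recursive_def by blast
  obtain rg where rg: "\<And>xs. length xs = n + 2 \<Longrightarrow> eval rg xs (g (xs ! 0) (xs ! 1) (drop 2 xs))"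
    using assms(2) unfolding recursive_def by blast
  obtain rh where rh: "\<And>xs. length xs = n \<Longrightarrow> eval rh xs (h xs)"
    using assms(3) unfolding recursive_def by blast
  have pr: "eval (PrimRec rf rg) (m # xs) (rec_nat (f xs) (\<lambda>y r. g y r xs) m)"
    if "length xs = n" for m xs
  proof (induct m)
    case 0
    then show ?case using rf[OF that] by (auto intro: eval_Pr0)
  next
    case (Suc m)
    then show ?case using rg[of "m # _ # xs"] that by (auto intro!: eval_PrS)
  qed
  \<comment> \<open>\<open>PrimRec\<close> recurses on its first argument; the projections copy the
    parameters \<open>xs\<close> behind the computed counter.\<close>
  have "eval (Comp (PrimRec rf rg) (rh # map Proj [0..<n])) xs
          (rec_nat (f xs) (\<lambda>y r. g y r xs) (h xs))" if "length xs = n" for xs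
  proof (rule eval_Comp)
    show "list_all2 (\<lambda>g y. eval g xs y) (rh # map Proj [0..<n]) (h xs # xs)"
      using rh that by (auto simp: list_all2_conv_all_nth nth_Cons intro!: eval_Proj split: nat.split)
  qed (rule pr[OF that])
  then show ?thesis unfolding recursive_def by blast
qed

section \<open>Arithmetic and the Cantor pairing\<close>

lemma recursive_add: "recursive n f \<Longrightarrow> recursive n g \<Longrightarrow> recursive n (\<lambda>xs. f xs + g xs)"
proof (rule recursive_comp2[of "(+)"])
  have "recursive 2 (\<lambda>xs. rec_nat (xs ! 1) (\<lambda>y r. Suc r) (xs ! 0))"
    by (rule recursive_rec_nat[where g = "\<lambda>y r xs. Suc r"])
      (intro recursive_proj recursive_Suc; simp)+
  moreover have "rec_nat b (\<lambda>y r. Suc r) a = a + b" for a b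
    by (induct a) auto
  ultimately show "recursive 2 (\<lambda>xs. xs ! 0 + xs ! 1)" by simp
qed

lemma recursive_diff: "recursive n f \<Longrightarrow> recursive n g \<Longrightarrow> recursive n (\<lambda>xs. f xs - g xs)"
proof (rule recursive_comp2[of "(-)"])
  have p: "recursive 1 (\<lambda>xs. rec_nat 0 (\<lambda>y r. y) (xs ! 0))"
    by (rule recursive_rec_nat[where g = "\<lambda>y r xs. y"])
      (auto intro: recursive_proj recursive_const)
  have "rec_nat 0 (\<lambda>y r. y) a = a - 1" for a :: nat
    by (cases a) auto
  with p have p: "recursive 1 (\<lambda>xs. xs ! 0 - 1)" by simp
  have "recursive 2 (\<lambda>xs. rec_nat (xs ! 0) (\<lambda>y r. r - 1) (xs ! 1))"
    by (rule recursive_rec_nat[where g = "\<lambda>y r xs. r - 1"])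
      (intro recursive_proj recursive_comp1[OF p]; simp)+
  moreover have "rec_nat a (\<lambda>y r. r - 1) b = a - b" for a b :: nat
    by (induct b) auto
  ultimately show "recursive 2 (\<lambda>xs. xs ! 0 - xs ! 1)" by simp
qed

lemma recursive_if_zero:
  assumes "recursive n f" "recursive n g" "recursive n h"
  shows "recursive n (\<lambda>xs. if f xs = 0 then g xs else h xs)"
proof -
  have *: "recursive 2 (\<lambda>xs. rec_nat (xs ! 1) (\<lambda>y r. 0) (xs ! 0))"
    by (rule recursive_rec_nat[where g = "\<lambda>y r xs. 0"])
      (auto intro: recursive_proj recursive_const)
  have "rec_nat b (\<lambda>y r. 0) a = (if a = 0 then b else 0)" for a b :: nat
    by (cases a) auto
  with * have z: "recursive 2 (\<lambda>xs. if xs ! 0 = 0 then xs ! 1 else 0)" by (simp only:)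
  \<comment> \<open>Both branches are total, so both may be evaluated. The truncated
    \<open>1 - f xs\<close> is zero exactly if \<open>f xs\<close> is not, so the unselected branch
    contributes 0.\<close>
  have "recursive n (\<lambda>xs. (if f xs = 0 then g xs else 0) + (if 1 - f xs = 0 then h xs else 0))"
    by (intro recursive_add recursive_comp2[OF z] recursive_diff recursive_const assms)
  moreover have "(\<lambda>xs. (if f xs = 0 then g xs else 0) + (if 1 - f xs = 0 then h xs else 0))
     = (\<lambda>xs. if f xs = 0 then g xs else h xs)" by (auto simp: fun_eq_iff)
  ultimately show ?thesis by simp
qed

lemma recursive_triangle: "recursive n f \<Longrightarrow> recursive n (\<lambda>xs. triangle (f xs))"
proof (rule recursive_comp1[of triangle])
  have "recursive 1 (\<lambda>xs. rec_nat 0 (\<lambda>y r. r + Suc y) (xs ! 0))"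
    by (rule recursive_rec_nat[where g = "\<lambda>y r xs. r + Suc y"])
      (auto intro!: recursive_proj recursive_const recursive_add recursive_Suc simp del: add_Suc_right)
  moreover have "rec_nat 0 (\<lambda>y r. r + Suc y) a = triangle a" for a
    by (induct a) auto
  ultimately show "recursive 1 (\<lambda>xs. triangle (xs ! 0))" by simp
qed

lemma recursive_prod_encode:
  "recursive n f \<Longrightarrow> recursive n g \<Longrightarrow> recursive n (\<lambda>xs. prod_encode (f xs, g xs))"
  unfolding prod_encode_def by (simp add: recursive_add recursive_triangle)

text \<open>The number of the antidiagonal on which an argument lies in the Cantor pairing.\<close>

definition diagonal :: "nat \<Rightarrow> nat" where
  "diagonal = rec_nat 0 (\<lambda>y s. if triangle (Suc s) - Suc y = 0 then Suc s else s)"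

lemma triangle_mono: "a \<le> b \<Longrightarrow> triangle a \<le> triangle b"
  by (induct b) (auto simp: le_Suc_eq)

text \<open>The successor of a number stays on its antidiagonal or is the first point of the next
  one, so a recursion that raises the index by at most one per step keeps up.\<close>

lemma diagonal_bounds: "triangle (diagonal n) \<le> n \<and> n < triangle (Suc (diagonal n))"
  by (induct n) (auto simp: diagonal_def)

lemma diagonal_prod_encode: "diagonal (prod_encode (a, b)) = a + b"
proof -
  let ?n = "prod_encode (a, b)"
  have b: "triangle (a + b) \<le> ?n" "?n < triangle (Suc (a + b))"
    by (simp_all add: prod_encode_def)
  show ?thesis
    using diagonal_bounds[of ?n] b triangle_mono[of "Suc (a + b)" "diagonal ?n"]
      triangle_mono[of "Suc (diagonal ?n)" "a + b"]
    by (cases "diagonal ?n" "a + b" rule: linorder_cases) (auto simp del: triangle_Suc)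
qed

lemma prod_decode_diagonal:
  "fst (prod_decode n) = n - triangle (diagonal n)"
  "snd (prod_decode n) = diagonal n - (n - triangle (diagonal n))"
  using diagonal_prod_encode[of "fst (prod_decode n)" "snd (prod_decode n)"]
    prod_decode_inverse[of n]
  by (auto simp: prod_encode_def split_beta)

lemma recursive_diagonal: "recursive n f \<Longrightarrow> recursive n (\<lambda>xs. diagonal (f xs))"
proof (rule recursive_comp1[of diagonal])
  show "recursive 1 (\<lambda>xs. diagonal (xs ! 0))"
    unfolding diagonal_def
    by (rule recursive_rec_nat[where g = "\<lambda>y s xs. if triangle (Suc s) - Suc y = 0 then Suc s else s"])
      (intro recursive_const recursive_if_zero recursive_diff recursive_triangle recursive_Suc
        recursive_proj; simp)+
qed

lemma recursive_prod_decode: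
  assumes "recursive n f"
  shows "recursive n (\<lambda>xs. fst (prod_decode (f xs)))" "recursive n (\<lambda>xs. snd (prod_decode (f xs)))"
  unfolding prod_decode_diagonal
  by (intro recursive_diff recursive_triangle recursive_diagonal assms)+

section \<open>Goedel numberings of types\<close>

text \<open>Bijectivity, not just injectivity, makes \<open>decode\<close> total and a two-sided
  inverse: a search through all numbers is then a search through all data.\<close>

class godel =
  fixes code :: "'a \<Rightarrow> nat"
  assumes bij_code: "bij code"
begin

definition decode :: "nat \<Rightarrow> 'a" where
  "decode = inv code"

lemma decode_code [simp]: "decode (code x) = x"
  unfolding decode_def by (simp add: bij_code bij_is_inj)

lemma code_decode [simp]: "code (decode n) = n"
  unfolding decode_def by (simp add: bij_code bij_is_surj surj_f_inv_f)

lemma code_eq_iff [simp]: "code x = code y \<longleftrightarrow> x = y"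
  by (metis decode_code)

end

instantiation nat :: godel
begin
definition code_nat :: "nat \<Rightarrow> nat" where [simp]: "code_nat n = n"
instance by standard (simp add: bij_def inj_def surj_def)
end

instantiation prod :: (godel, godel) godel
begin
definition code_prod :: "'a \<times> 'b \<Rightarrow> nat" where
  "code_prod p = prod_encode (code (fst p), code (snd p))"
instance
proof
  show "bij (code :: 'a \<times> 'b \<Rightarrow> nat)"
    by (rule bij_betw_byWitness[where f' = "\<lambda>n. (decode (fst (prod_decode n)), decode (snd (prod_decode n)))"])
      (auto simp: code_prod_def)
qed
end

text \<open>The codes of options, lists and pairs agree with \<open>enc_opt\<close>,
  \<open>list_encode\<close> and \<open>prod_encode\<close>, so letters, number lists and constraint
  lists of the given inputs are read by \<open>decode\<close> alone.\<close>

instantiation option :: (godel) godel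
begin
definition code_option :: "'a option \<Rightarrow> nat" where
  "code_option x = (case x of None \<Rightarrow> 0 | Some c \<Rightarrow> Suc (code c))"
instance
proof
  show "bij (code :: 'a option \<Rightarrow> nat)"
    by (rule bij_betw_byWitness[where f' = "\<lambda>n. case n of 0 \<Rightarrow> None | Suc c \<Rightarrow> Some (decode c)"])
      (auto simp: code_option_def split: option.splits nat.splits)
qed
end

instantiation list :: (godel) godel
begin
definition code_list :: "'a list \<Rightarrow> nat" where
  "code_list xs = list_encode (map code xs)"
instance
proof
  show "bij (code :: 'a list \<Rightarrow> nat)"
    by (rule bij_betw_byWitness[where f' = "\<lambda>n. map decode (list_decode n)"])
      (auto simp: code_list_def comp_def)
qed
end

lemma code_Nil: "code [] = 0" and code_Cons: "code (x # xs) = Suc (code (x, xs))"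
  by (simp_all add: code_list_def code_prod_def)

section \<open>Computable functions between coded types\<close>

definition computable :: "('a::godel \<Rightarrow> 'b::godel) \<Rightarrow> bool" where
  "computable f \<longleftrightarrow> recursive 1 (\<lambda>xs. code (f (decode (xs ! 0))))"

definition decidable :: "('a::godel \<Rightarrow> bool) \<Rightarrow> bool" where
  "decidable P \<longleftrightarrow> computable (\<lambda>x. if P x then 1 else (0::nat))"

lemma decidable_eval:
  assumes "decidable P"
  obtains r where "\<And>x. eval r [code x] (if P x then 1 else 0)"
proof -
  obtain r where "\<And>xs. length xs = 1 \<Longrightarrow> eval r xs (if P (decode (xs ! 0)) then 1 else 0)"
    using assms unfolding decidable_def computable_def recursive_def by auto
  from this[of "[code x]" for x] have "eval r [code x] (if P x then 1 else 0)" for x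
    by (metis decode_code length_Cons list.size(3) nth_Cons_0 One_nat_def)
  then show ?thesis by (rule that)
qed

lemma decode_nat [simp]: "decode n = (n :: nat)"
  by (metis code_nat_def code_decode)

lemma computable_iff_code: "computable f \<longleftrightarrow> computable (\<lambda>x. code (f x))"
  by (simp add: computable_def)

lemma computable_const: "computable (\<lambda>x. c)"
  by (simp add: computable_def recursive_const)

lemma computable_id: "computable (\<lambda>x. x)"
  by (simp add: computable_def recursive_proj)

lemma computable_comp:
  assumes "computable g" "computable f"
  shows "computable (\<lambda>x. g (f x))"
  using recursive_comp1[OF assms(1)[unfolded computable_def] assms(2)[unfolded computable_def]]
  by (simp add: computable_def)

lemma computable_Pair:
  "computable f \<Longrightarrow> computable g \<Longrightarrow> computable (\<lambda>x. (f x, g x))"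
  by (simp add: computable_def code_prod_def recursive_prod_encode)

lemma decode_prod: "decode n = (decode (fst (prod_decode n)), decode (snd (prod_decode n)))"
  by (metis code_decode code_eq_iff code_prod_def fst_conv snd_conv prod.collapse prod_decode_inverse)

lemma computable_fst: "computable f \<Longrightarrow> computable (\<lambda>x. fst (f x))"
  by (rule computable_comp[of fst])
    (simp_all add: computable_def decode_prod recursive_prod_decode recursive_proj)

lemma computable_snd: "computable f \<Longrightarrow> computable (\<lambda>x. snd (f x))"
  by (rule computable_comp[of snd])
    (simp_all add: computable_def decode_prod recursive_prod_decode recursive_proj)

lemma computable_comp2:
  "computable (\<lambda>p. F (fst p) (snd p)) \<Longrightarrow> computable f \<Longrightarrow> computable g \<Longrightarrow> computable (\<lambda>x. F (f x) (g x))"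
  using computable_comp[of "\<lambda>p. F (fst p) (snd p)" "\<lambda>x. (f x, g x)"] by (simp add: computable_Pair)

lemma computable_case_prod:
  "computable (\<lambda>x. F x (fst (p x)) (snd (p x))) \<Longrightarrow> computable (\<lambda>x. case p x of (a, b) \<Rightarrow> F x a b)"
  by (simp add: split_beta)

lemma computable_Suc: "computable f \<Longrightarrow> computable (\<lambda>x. Suc (f x))"
  and computable_diff: "computable f \<Longrightarrow> computable g \<Longrightarrow> computable (\<lambda>x. f x - g x :: nat)"
  and computable_add: "computable f \<Longrightarrow> computable g \<Longrightarrow> computable (\<lambda>x. f x + g x :: nat)"
  by (simp_all add: computable_def recursive_Suc recursive_diff recursive_add)

lemma computable_decode: "computable f \<Longrightarrow> computable (\<lambda>x. decode (f x))"
  by (simp add: computable_def)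

lemma computable_code: "computable f \<Longrightarrow> computable (\<lambda>x. code (f x))"
  by (simp add: computable_def)

text \<open>The recursion is simulated on codes. Computable functions are unary, so the step
  function receives a nested pair of parameter, counter and previous value; \<open>?p\<close>
  rearranges the arguments supplied by primitive recursion into this order.\<close>

lemma computable_rec_nat:
  fixes f :: "'a::godel \<Rightarrow> 'b::godel"
  assumes "computable f" "computable (\<lambda>z. G (fst z) (fst (snd z)) (snd (snd z)))" "computable h"
  shows "computable (\<lambda>x. rec_nat (f x) (G x) (h x))"
proof -
  have *: "code (rec_nat (f x) (G x) n) =
    rec_nat (code (f x)) (\<lambda>y r. code (G x y (decode r))) n" for x n
    by (induct n) (simp_all, metis decode_code)
  let ?G = "\<lambda>y r xs. code (G (decode (xs ! 0)) y (decode r))"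
  let ?d = "decode :: nat \<Rightarrow> 'a \<times> nat \<times> 'b"
  let ?p = "\<lambda>ys. prod_encode (ys ! 2, prod_encode (ys ! 0, ys ! 1))"
  have "recursive 3 (\<lambda>ys. code (G (fst (?d (?p ys))) (fst (snd (?d (?p ys)))) (snd (snd (?d (?p ys))))))"
    by (rule recursive_comp1[of "\<lambda>n. code (G (fst (?d n)) (fst (snd (?d n))) (snd (snd (?d n))))",
          OF assms(2)[unfolded computable_def]])
      (intro recursive_prod_encode recursive_proj; simp)
  then have "recursive (1 + 2) (\<lambda>ys. ?G (ys ! 0) (ys ! 1) (drop 2 ys))"
    unfolding recursive_def by (auto simp: decode_prod numeral_3_eq_3)
  from recursive_rec_nat[of 1, OF assms(1)[unfolded computable_def] this assms(3)[unfolded computable_def]]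
  show ?thesis by (simp add: computable_def *)
qed

lemma computable_if:
  assumes "decidable P" "computable f" "computable g"
  shows "computable (\<lambda>x. if P x then f x else g x)"
proof -
  \<comment> \<open>A recursion of depth 0 or 1 serves as case distinction.\<close>
  have "(if P x then f x else g x) = rec_nat (g x) (\<lambda>_ _. f x) (if P x then 1 else 0)" for x
    by simp
  moreover have "computable (\<lambda>x. rec_nat (g x) (\<lambda>_ _. f x) (if P x then 1 else 0))"
    using assms unfolding decidable_def 
    by (intro computable_rec_nat computable_comp[OF assms(2) computable_fst[OF computable_id]])
  ultimately show ?thesis by (simp only:)
qed

lemma decidable_comp: "decidable P \<Longrightarrow> computable f \<Longrightarrow> decidable (\<lambda>x. P (f x))"
  unfolding decidable_def by (rule computable_comp[of "\<lambda>x. if P x then 1 else 0" f])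

lemma decidable_comp2:
  "decidable (\<lambda>p. P (fst p) (snd p)) \<Longrightarrow> computable f \<Longrightarrow> computable g \<Longrightarrow> decidable (\<lambda>x. P (f x) (g x))"
  unfolding decidable_def by (rule computable_comp2[of "\<lambda>x y. if P x y then 1 else 0" f g])

lemma decidable_const: "decidable (\<lambda>x. b)"
  by (simp add: decidable_def computable_const)

lemma decidable_if:
  "decidable P \<Longrightarrow> decidable Q \<Longrightarrow> decidable R \<Longrightarrow> decidable (\<lambda>x. if P x then Q x else R x)"
proof -
  assume *: "decidable P" "decidable Q" "decidable R"
  have "(\<lambda>x. if if P x then Q x else R x then 1 else 0::nat) =
    (\<lambda>x. if P x then if Q x then 1 else 0 else if R x then 1 else 0)" by auto
  with * show ?thesis
    using computable_if[OF *(1) *(2,3)[unfolded decidable_def]] by (simp add: decidable_def)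
qed

lemma decidable_not: "decidable P \<Longrightarrow> decidable (\<lambda>x. \<not> P x)"
proof -
  assume "decidable P"
  then have "decidable (\<lambda>x. if P x then False else True)"
    by (intro decidable_if decidable_const)
  moreover have "(if P x then False else True) \<longleftrightarrow> \<not> P x" for x by simp
  ultimately show ?thesis by (simp only:)
qed

lemma decidable_conj: "decidable P \<Longrightarrow> decidable Q \<Longrightarrow> decidable (\<lambda>x. P x \<and> Q x)"
proof -
  assume "decidable P" "decidable Q"
  then have "decidable (\<lambda>x. if P x then Q x else False)"
    by (intro decidable_if decidable_const)
  moreover have "(if P x then Q x else False) \<longleftrightarrow> P x \<and> Q x" for x by simp
  ultimately show ?thesis by (simp only:)
qed

lemma decidable_disj: "decidable P \<Longrightarrow> decidable Q \<Longrightarrow> decidable (\<lambda>x. P x \<or> Q x)"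
proof -
  assume "decidable P" "decidable Q"
  then have "decidable (\<lambda>x. \<not> (\<not> P x \<and> \<not> Q x))"
    by (intro decidable_not decidable_conj)
  then show ?thesis by simp
qed

lemma decidable_imp: "decidable P \<Longrightarrow> decidable Q \<Longrightarrow> decidable (\<lambda>x. P x \<longrightarrow> Q x)"
  unfolding imp_conv_disj by (intro decidable_disj decidable_not)

lemma decidable_case_prod:
  "decidable (\<lambda>x. F x (fst (p x)) (snd (p x))) \<Longrightarrow> decidable (\<lambda>x. case p x of (a, b) \<Rightarrow> F x a b)"
  by (simp add: split_beta)

lemma decidable_eq_0: "computable f \<Longrightarrow> decidable (\<lambda>x. f x = (0::nat))"
  by (auto simp: decidable_def computable_def if_distrib[of code] cong: if_cong
      intro!: recursive_if_zero recursive_const)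

text \<open>Injectivity of \<open>code\<close> reduces equality in any coded type to numbers, which
  are equal iff both truncated differences vanish.\<close>

lemma decidable_eq:
  assumes "computable f" "computable g"
  shows "decidable (\<lambda>x. f x = g x)"
proof -
  have "decidable (\<lambda>x. (code (f x) - code (g x)) + (code (g x) - code (f x)) = 0)"
    by (intro decidable_eq_0 computable_add computable_diff computable_code assms)
  moreover have "(code (f x) - code (g x)) + (code (g x) - code (f x)) = 0 \<longleftrightarrow> f x = g x" for x
    by (metis add_is_0 code_eq_iff diff_is_0_eq diff_self_eq_0 le_antisym)
  ultimately show ?thesis by simp
qed

section \<open>Unbounded search\<close>

text \<open>The one place where \<open>Mu\<close> enters. Since \<open>Mu\<close> looks for the
  value 0 and needs defined positive values before it, the test is negated: 0 stands for success.
  The second assumption makes the search terminate on every input.\<close>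

lemma computable_Least:
  fixes T :: "'a::godel \<Rightarrow> nat \<Rightarrow> bool"
  assumes "decidable (\<lambda>z. T (fst z) (snd z))" "\<And>x. \<exists>n. T x n"
  shows "computable (\<lambda>x. LEAST n::nat. T x n)"
proof -
  let ?t = "\<lambda>n x. if \<not> T (decode x) n then 1 else 0::nat"
  let ?d = "decode :: nat \<Rightarrow> 'a \<times> nat"
  let ?p = "\<lambda>xs. prod_encode (xs ! 1, xs ! 0)"
  have "recursive 1 (\<lambda>xs. if \<not> T (fst (?d (xs ! 0))) (snd (?d (xs ! 0))) then 1 else 0::nat)"
    using decidable_not[OF assms(1)] unfolding decidable_def computable_def code_nat_def .
  then have "recursive 2 (\<lambda>xs. if \<not> T (fst (?d (?p xs))) (snd (?d (?p xs))) then 1 else 0)"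
    by (rule recursive_comp1[where f = "\<lambda>n. if \<not> T (fst (?d n)) (snd (?d n)) then 1 else 0::nat"])
      (intro recursive_prod_encode recursive_proj; simp)
  then obtain r where r: "\<And>xs. length xs = 2 \<Longrightarrow> eval r xs (?t (xs ! 0) (xs ! 1))"
    unfolding recursive_def by (auto simp: decode_prod)
  have t: "eval r [n, x] (?t n x)" for n x
    using r[of "[n, x]"] by simp
  have "eval (Mu r) [x] (LEAST n. T (decode x) n)" for x
  proof (rule eval_Mu)
    show "eval r [LEAST n. T (decode x) n, x] 0"
      using t[of "LEAST n. T (decode x) n" x] LeastI_ex[OF assms(2)] by simp
    show "\<forall>z<LEAST n. T (decode x) n. \<exists>v>0. eval r [z, x] v"
    proof (intro allI impI)
      fix z assume "z < (LEAST n. T (decode x) n)"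
      then have "\<not> T (decode x) z" by (rule not_less_Least)
      then show "\<exists>v>0. eval r [z, x] v" using t[of z x] by (intro exI[of _ 1]) simp
    qed
  qed
  then have "eval (Mu r) xs (LEAST n. T (decode (xs ! 0)) n)" if "length xs = 1" for xs
    using that by (auto simp: length_Suc_conv)
  then show ?thesis unfolding computable_def recursive_def by auto
qed

text \<open>Post's theorem: a predicate is decidable if it and its complement both have checkable
  certificates.\<close>

lemma decidable_complementary_searches:
  fixes Q :: "'a::godel \<Rightarrow> 'b::godel \<Rightarrow> bool" and R :: "'a \<Rightarrow> 'c::godel \<Rightarrow> bool"
  assumes Q: "decidable (\<lambda>z. Q (fst z) (snd z))" and R: "decidable (\<lambda>z. R (fst z) (snd z))"
    and PQ: "\<And>x. P x \<longleftrightarrow> (\<exists>y. Q x y)" and PR: "\<And>x. \<not> P x \<longleftrightarrow> (\<exists>y. R x y)"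
  shows "decidable P"
proof -
  \<comment> \<open>The same number is decoded in both types, once as a certificate for
    \<open>Q\<close> and once for \<open>R\<close>; at the first hit it remains to test whether it
    was one for \<open>Q\<close>.\<close>
  let ?T = "\<lambda>x n. Q x (decode n) \<or> R x (decode n)"
  have ex: "\<exists>n. ?T x n" for x
    using PQ[of x] PR[of x] by (metis decode_code)
  have "computable (\<lambda>x. LEAST n. ?T x n)"
    by (rule computable_Least[OF _ ex])
      (intro decidable_disj decidable_comp2[of Q, OF Q] decidable_comp2[of R, OF R]
        computable_decode computable_fst computable_snd computable_id)
  then have "decidable (\<lambda>x. Q x (decode (LEAST n. ?T x n)))"
    by (intro decidable_comp2[of Q, OF Q] computable_decode computable_id)
  moreover have "Q x (decode (LEAST n. ?T x n)) \<longleftrightarrow> P x" for x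
    using LeastI_ex[OF ex[of x]] PQ[of x] PR[of x] by blast
  ultimately show ?thesis by simp
qed

section \<open>Computable operations on options and lists\<close>

lemma computable_Cons: "computable f \<Longrightarrow> computable g \<Longrightarrow> computable (\<lambda>x. f x # g x)"
  by (subst computable_iff_code, unfold code_Cons) (intro computable_Suc computable_code computable_Pair)

lemma computable_Some: "computable f \<Longrightarrow> computable (\<lambda>x. Some (f x))"
  by (subst computable_iff_code) (simp add: code_option_def computable_Suc computable_code)

lemma computable_comp3:
  assumes "computable (\<lambda>z. G (fst z) (fst (snd z)) (snd (snd z)))" "computable f" "computable g" "computable h"
  shows "computable (\<lambda>x. G (f x) (g x) (h x))"
  using computable_comp[OF assms(1), of "\<lambda>x. (f x, g x, h x)"] assms(2-) by (simp add: computable_Pair)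

text \<open>A nonempty list has as code the successor of the code of the pair of head and tail, so
  decoding the predecessor as a pair takes it apart.\<close>

lemma computable_case_list:
  fixes l :: "'a::godel \<Rightarrow> 'b::godel list"
  assumes "computable f" "computable (\<lambda>z. G (fst z) (fst (snd z)) (snd (snd z)))" "computable l"
  shows "computable (\<lambda>x. case l x of [] \<Rightarrow> f x | y # ys \<Rightarrow> G x y ys)"
proof -
  let ?d = "decode :: nat \<Rightarrow> 'b \<times> 'b list"
  have "(case l x of [] \<Rightarrow> f x | y # ys \<Rightarrow> G x y ys) =
    (if code (l x) = 0 then f x
     else G x (fst (?d (code (l x) - 1))) (snd (?d (code (l x) - 1))))" for x
    by (cases "l x") (auto simp: code_Nil code_Cons)
  then show ?thesis
    by (simp only:)
      (intro computable_if decidable_eq computable_code computable_comp3[of G, OF assms(2)] assms(1,3)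
        computable_fst computable_snd computable_decode computable_diff computable_const computable_id)
qed

lemma computable_case_option:
  assumes "computable f" "computable (\<lambda>z. G (fst z) (snd z))" "computable l"
  shows "computable (\<lambda>x. case l x of None \<Rightarrow> f x | Some y \<Rightarrow> G x y)"
proof -
  have "(case l x of None \<Rightarrow> f x | Some y \<Rightarrow> G x y) =
    (if code (l x) = 0 then f x else G x (decode (code (l x) - 1)))" for x
    by (cases "l x") (auto simp: code_option_def)
  then show ?thesis
    by (simp only:)
      (intro computable_if decidable_eq computable_code computable_comp2[of G, OF assms(2)] assms(1,3)
        computable_decode computable_diff computable_const computable_id)
qed

text \<open>Lets the code of a list serve as a sufficient number of rounds for a recursion along
  that list.\<close>

lemma length_le_code: "length xs \<le> code xs"
proof (induct xs)
  case (Cons x xs)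
  then show ?case
    using le_prod_encode_2[of "code xs" "code x"] by (simp add: code_Cons code_prod_def)
qed simp

text \<open>The state consists of the remaining list and the accumulator. It no longer changes once
  the list is exhausted, so surplus rounds are harmless.\<close>

lemma computable_foldl:
  assumes F: "computable (\<lambda>z. F (fst z) (fst (snd z)) (snd (snd z)))" and "computable a" "computable l"
  shows "computable (\<lambda>x. foldl (F x) (a x) (l x))"
proof -
  let ?step = "\<lambda>x s. case fst s of [] \<Rightarrow> s | y # ys \<Rightarrow> (ys, F x (snd s) y)"
  have steps: "rec_nat (ys, b) (\<lambda>_. ?step x) n = (drop n ys, foldl (F x) b (take n ys))" for x ys b n
  proof (induct n)
    case (Suc n)
    show ?case
    proof (cases "n < length ys")
      case True
      then have "drop n ys = ys ! n # drop (Suc n) ys" by (rule Cons_nth_drop_Suc[symmetric])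
      with Suc True show ?thesis by (simp add: take_Suc_conv_app_nth)
    qed (use Suc in simp)
  qed simp
  have "foldl (F x) (a x) (l x) = snd (rec_nat (l x, a x) (\<lambda>_. ?step x) (code (l x)))" for x
    by (simp add: steps length_le_code)
  then show ?thesis
    by (simp only:)
      (intro computable_snd computable_rec_nat computable_case_list computable_Pair computable_code
        computable_comp3[of F, OF F] computable_fst computable_id assms)
qed

lemma computable_rev: "computable l \<Longrightarrow> computable (\<lambda>x. rev (l x))"
proof -
  assume l: "computable l"
  have "foldl (\<lambda>a y. y # a) b xs = rev xs @ b" for b xs :: "'b list"
    by (induct xs arbitrary: b) auto
  then have "rev xs = foldl (\<lambda>a y. y # a) [] xs" for xs :: "'b list"
    by simp
  then show ?thesis
    by (simp only:) (intro computable_foldl computable_Cons computable_fst computable_snd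
        computable_const computable_id l)
qed

lemma computable_foldr:
  assumes F: "computable (\<lambda>z. F (fst z) (fst (snd z)) (snd (snd z)))" and "computable a" "computable l"
  shows "computable (\<lambda>x. foldr (F x) (l x) (a x))"
  unfolding foldr_conv_foldl
  by (intro computable_foldl computable_rev computable_comp3[of F, OF F] computable_fst computable_snd
      computable_id assms)

lemma computable_append: "computable f \<Longrightarrow> computable g \<Longrightarrow> computable (\<lambda>x. f x @ g x)"
proof -
  assume *: "computable f" "computable g"
  have "xs @ ys = foldr (#) xs ys" for xs ys :: "'b list" by (induct xs) simp_all
  then show ?thesis
    by (simp only:)
      (intro computable_foldr[of "\<lambda>_. (#)"] computable_Cons computable_fst computable_snd computable_id *)
qed

lemma computable_map:
  assumes F: "computable (\<lambda>z. F (fst z) (snd z))" and "computable l"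
  shows "computable (\<lambda>x. map (F x) (l x))"
proof -
  have "map f xs = foldr (\<lambda>y ys. f y # ys) xs []" for f :: "'b \<Rightarrow> 'c" and xs
    by (induct xs) simp_all
  then show ?thesis
    by (simp only:) (intro computable_foldr computable_Cons computable_comp2[of F, OF F] computable_fst
      computable_snd computable_const computable_id assms)
qed

lemma computable_filter:
  assumes P: "decidable (\<lambda>z. P (fst z) (snd z))" and "computable l"
  shows "computable (\<lambda>x. filter (P x) (l x))"
proof -
  have "filter Q xs = foldr (\<lambda>y ys. if Q y then y # ys else ys) xs []" for Q and xs :: "'b list"
    by (induct xs) simp_all
  then show ?thesis
    by (simp only:) (intro computable_foldr computable_if computable_Cons decidable_comp2[of P, OF P]
      computable_fst computable_snd computable_const computable_id assms)
qed

lemma computable_concat: "computable l \<Longrightarrow> computable (\<lambda>x. concat (l x))"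
  unfolding concat_conv_foldr
  by (intro computable_foldr[of "\<lambda>_. (@)"] computable_append computable_fst computable_snd
      computable_const computable_id)

lemma computable_length: "computable l \<Longrightarrow> computable (\<lambda>x. length (l x))"
proof -
  assume l: "computable l"
  have "length xs = foldr (\<lambda>_. Suc) xs 0" for xs :: "'b list"
    by (induct xs) simp_all
  then show ?thesis
    by (simp only:) (intro computable_foldr computable_Suc computable_fst computable_snd
      computable_const computable_id l)
qed

lemma computable_upt: "computable f \<Longrightarrow> computable (\<lambda>x. [0..<f x])"
proof -
  assume f: "computable f"
  have "[0..<n] = rec_nat [] (\<lambda>i r. r @ [i]) n" for n
    by (induct n) simp_all
  then show ?thesis
    by (simp only:) (intro computable_rec_nat computable_append computable_Cons computable_fst computable_snd
      computable_const computable_id f)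
qed

lemma computable_n_lists:
  assumes "computable f" "computable l"
  shows "computable (\<lambda>x. List.n_lists (f x) (l x))"
proof -
  have "List.n_lists n xs = rec_nat [[]] (\<lambda>_ r. concat (map (\<lambda>ys. map (\<lambda>y. y # ys) xs) r)) n"
    for n and xs :: "'b list"
    by (induct n) simp_all
  then show ?thesis
    by (simp only:) (intro computable_rec_nat computable_concat computable_map computable_Cons computable_fst
      computable_comp[OF assms(2)] computable_snd computable_const computable_id assms)
qed

text \<open>Unlike \<^const>\<open>nth\<close>, whose value out of range is unspecified and so need not be computable,
  this look-up is total.\<close>

definition lookup :: "'a \<Rightarrow> 'a list \<Rightarrow> nat \<Rightarrow> 'a" where
  "lookup d xs i = (case drop i xs of [] \<Rightarrow> d | y # ys \<Rightarrow> y)"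

lemma lookup_nth [simp]: "i < length xs \<Longrightarrow> lookup d xs i = xs ! i"
  by (simp add: lookup_def Cons_nth_drop_Suc[symmetric])

lemma computable_lookup:
  assumes "computable d" "computable l" "computable f"
  shows "computable (\<lambda>x. lookup (d x) (l x) (f x))"
proof -
  have tl: "tl r = (case r of [] \<Rightarrow> r | y # ys \<Rightarrow> ys)" for r :: "'b list"
    by (cases r) simp_all
  have "drop n xs = rec_nat xs (\<lambda>_ r. tl r) n" for n and xs :: "'b list"
    by (induct n) (simp_all add: drop_Suc drop_tl)
  then have "drop n xs = rec_nat xs (\<lambda>_ r. case r of [] \<Rightarrow> r | y # ys \<Rightarrow> ys) n" for n and xs :: "'b list"
    by (simp only: tl)
  then show ?thesis unfolding lookup_def
    by (simp only:) (intro computable_case_list computable_rec_nat computable_fst computable_snd computable_id assms)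
qed

lemma decidable_Ball:
  assumes P: "decidable (\<lambda>z. P (fst z) (snd z))" and "computable l"
  shows "decidable (\<lambda>x. \<forall>y\<in>set (l x). P x y)"
proof -
  have "(\<forall>y\<in>set (l x). P x y) \<longleftrightarrow> filter (\<lambda>y. \<not> P x y) (l x) = []" for x
    by (simp add: filter_empty_conv)
  then show ?thesis
    by (simp only:) (intro decidable_eq computable_filter decidable_not computable_const assms)
qed

lemma decidable_Bex:
  assumes P: "decidable (\<lambda>z. P (fst z) (snd z))" and "computable l"
  shows "decidable (\<lambda>x. \<exists>y\<in>set (l x). P x y)"
proof -
  have "(\<exists>y\<in>set (l x). P x y) \<longleftrightarrow> \<not> (\<forall>y\<in>set (l x). \<not> P x y)" for x
    by simp
  then show ?thesis
    by (simp only:) (intro decidable_Ball decidable_not assms)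
qed

lemma decidable_in_set:
  fixes f :: "'a::godel \<Rightarrow> 'b::godel"
  assumes "computable f" "computable l"
  shows "decidable (\<lambda>x. f x \<in> set (l x))"
proof -
  have "y \<in> set ys \<longleftrightarrow> (\<exists>z\<in>set ys. y = z)" for y :: 'b and ys
    by auto
  moreover have "decidable (\<lambda>x. \<exists>z\<in>set (l x). f x = z)"
    by (intro decidable_Bex decidable_eq computable_comp[OF assms(1)] computable_fst computable_snd
        computable_id assms(2))
  ultimately show ?thesis by (simp only:)
qed

lemma decidable_all_less:
  assumes P: "decidable (\<lambda>z. P (fst z) (snd z))" and "computable f"
  shows "decidable (\<lambda>x. \<forall>i<f x :: nat. P x i)"
proof -
  have "(\<forall>i<f x. P x i) \<longleftrightarrow> (\<forall>i\<in>set [0..<f x]. P x i)" for x by auto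
  then show ?thesis
    by (simp only:) (intro decidable_Ball computable_upt assms)
qed

text \<open>Greedy leftmost matching; the state is the part of \<open>xs\<close> still to be found
  in the rest of \<open>ys\<close>.\<close>

lemma subseq_conv_foldl:
  "subseq xs ys \<longleftrightarrow> foldl (\<lambda>r y. case r of [] \<Rightarrow> r | x # r' \<Rightarrow> if x = y then r' else r) xs ys = []"
proof (induct ys arbitrary: xs)
  case (Cons y ys)
  then show ?case by (cases xs) (auto simp: subseq_Cons2_iff)
qed (auto elim: list_emb.cases)

lemma decidable_subseq:
  assumes "computable f" "computable g"
  shows "decidable (\<lambda>x. subseq (f x) (g x))"
  unfolding subseq_conv_foldl
  by (intro decidable_eq computable_foldl computable_case_list computable_if computable_fst computable_snd
      computable_const computable_id assms)

text \<open>One rule per construct: a computability proof then follows the syntax of the defining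
  term.\<close>

lemmas computable_intros =
  computable_const computable_id computable_Pair computable_fst computable_snd computable_case_prod
  computable_Suc computable_diff computable_add computable_decode computable_code computable_rec_nat
  computable_if computable_Cons computable_Some computable_case_list computable_case_option
  computable_foldl computable_append computable_map computable_filter computable_concat computable_length
  computable_upt computable_n_lists computable_lookup
  decidable_const decidable_not decidable_conj decidable_disj decidable_imp decidable_case_prod
  decidable_eq decidable_Ball decidable_Bex decidable_in_set decidable_all_less decidable_subseq

section \<open>Well-quasi-orders and the subword order\<close>

text \<open>An increasing infinite subsequence, unlike a single increasing pair, can be thinned
  again; products are then handled by extracting twice.\<close>

definition wqo_on :: "('a \<Rightarrow> 'a \<Rightarrow> bool) \<Rightarrow> 'a set \<Rightarrow> bool" where
  "wqo_on P A \<longleftrightarrow> (\<forall>f::nat \<Rightarrow> 'a. (\<forall>i. f i \<in> A) \<longrightarrow>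
     (\<exists>\<phi>::nat \<Rightarrow> nat. strict_mono \<phi> \<and> (\<forall>i j. i < j \<longrightarrow> P (f (\<phi> i)) (f (\<phi> j)))))"

lemma wqo_onE:
  fixes f :: "nat \<Rightarrow> 'a"
  assumes "wqo_on P A" "\<And>i. f i \<in> A"
  obtains \<phi> :: "nat \<Rightarrow> nat" where "strict_mono \<phi>" "\<And>i j. i < j \<Longrightarrow> P (f (\<phi> i)) (f (\<phi> j))"
  using assms unfolding wqo_on_def by blast

lemma wqo_on_subset: "wqo_on P B \<Longrightarrow> A \<subseteq> B \<Longrightarrow> wqo_on P A"
  unfolding wqo_on_def by blast

lemma wqo_on_subsequence:
  fixes f :: "nat \<Rightarrow> 'a"
  assumes "wqo_on P A" "infinite {i. f i \<in> A}"
  shows "\<exists>\<phi>::nat \<Rightarrow> nat. strict_mono \<phi> \<and> (\<forall>i j. i < j \<longrightarrow> P (f (\<phi> i)) (f (\<phi> j)))"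
proof -
  obtain r :: "nat \<Rightarrow> nat" where r: "strict_mono r" "\<And>n. f (r n) \<in> A"
    using infinite_enumerate[OF assms(2)] by auto
  obtain \<phi> :: "nat \<Rightarrow> nat" where "strict_mono \<phi>" "\<And>i j. i < j \<Longrightarrow> P (f (r (\<phi> i))) (f (r (\<phi> j)))"
    by (rule wqo_onE[OF assms(1), of "\<lambda>n. f (r n)", OF r(2)]) blast
  with r(1) show ?thesis by (intro exI[of _ "r \<circ> \<phi>"]) (simp add: strict_mono_def)
qed

lemma wqo_on_Un:
  assumes "wqo_on P A" "wqo_on P B"
  shows "wqo_on P (A \<union> B)"
  unfolding wqo_on_def
proof (intro allI impI)
  fix f :: "nat \<Rightarrow> 'a"
  assume "\<forall>i. f i \<in> A \<union> B"
  then have "{i. f i \<in> A} \<union> {i. f i \<in> B} = UNIV" by auto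
  then have "infinite {i. f i \<in> A} \<or> infinite {i. f i \<in> B}"
    by (metis finite_Un infinite_UNIV_nat)
  then show "\<exists>\<phi>::nat \<Rightarrow> nat. strict_mono \<phi> \<and> (\<forall>i j. i < j \<longrightarrow> P (f (\<phi> i)) (f (\<phi> j)))"
    using assms wqo_on_subsequence by blast
qed

lemma wqo_on_Times:
  assumes "wqo_on P A" "wqo_on Q B"
  shows "wqo_on (\<lambda>x y. P (fst x) (fst y) \<and> Q (snd x) (snd y)) (A \<times> B)"
  unfolding wqo_on_def
proof (intro allI impI)
  fix f :: "nat \<Rightarrow> 'a \<times> 'b"
  assume f: "\<forall>i. f i \<in> A \<times> B"
  from f have f1: "fst (f i) \<in> A" and f2: "snd (f i) \<in> B" for i
    by (simp_all add: mem_Times_iff)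
  obtain \<phi> :: "nat \<Rightarrow> nat" where \<phi>: "strict_mono \<phi>" "\<And>i j. i < j \<Longrightarrow> P (fst (f (\<phi> i))) (fst (f (\<phi> j)))"
    by (rule wqo_onE[OF assms(1), of "\<lambda>n. fst (f n)", OF f1]) blast
  obtain \<psi> :: "nat \<Rightarrow> nat" where \<psi>: "strict_mono \<psi>" "\<And>i j. i < j \<Longrightarrow> Q (snd (f (\<phi> (\<psi> i)))) (snd (f (\<phi> (\<psi> j))))"
    by (rule wqo_onE[OF assms(2), of "\<lambda>n. snd (f (\<phi> n))", OF f2]) blast
  show "\<exists>\<phi>::nat \<Rightarrow> nat. strict_mono \<phi> \<and>
      (\<forall>i j. i < j \<longrightarrow> P (fst (f (\<phi> i))) (fst (f (\<phi> j))) \<and> Q (snd (f (\<phi> i))) (snd (f (\<phi> j))))"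
    using \<phi> \<psi> by (intro exI[of _ "\<phi> \<circ> \<psi>"]) (simp add: strict_mono_def)
qed

text \<open>Carries the order along a constructor, below for gluing two words around a letter and
  for prepending a tuple entry.\<close>

lemma wqo_on_image:
  assumes "wqo_on P A" "\<And>x y. x \<in> A \<Longrightarrow> y \<in> A \<Longrightarrow> P x y \<Longrightarrow> Q (h x) (h y)"
  shows "wqo_on Q (h ` A)"
  unfolding wqo_on_def
proof (intro allI impI)
  fix f :: "nat \<Rightarrow> 'b"
  assume "\<forall>i. f i \<in> h ` A"
  then obtain g where g: "\<And>i. g i \<in> A" "\<And>i. f i = h (g i)"
    unfolding image_iff Bex_def by metis
  obtain \<phi> :: "nat \<Rightarrow> nat" where "strict_mono \<phi>" "\<And>i j. i < j \<Longrightarrow> P (g (\<phi> i)) (g (\<phi> j))"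
    by (rule wqo_onE[OF assms(1), of g, OF g(1)]) blast
  then show "\<exists>\<phi>::nat \<Rightarrow> nat. strict_mono \<phi> \<and> (\<forall>i j. i < j \<longrightarrow> Q (f (\<phi> i)) (f (\<phi> j)))"
    using assms(2) g by (intro exI[of _ \<phi>]) simp
qed

lemma wqo_on_eq_finite:
  assumes "finite A"
  shows "wqo_on (=) A"
  unfolding wqo_on_def
proof (intro allI impI)
  fix f :: "nat \<Rightarrow> 'a"
  assume "\<forall>i. f i \<in> A"
  then have "finite (range f)" using assms by (meson finite_subset image_subsetI)
  then obtain a where "infinite {i. f i = f a}"
    using pigeonhole_infinite[of "UNIV :: nat set" f] by auto
  moreover have "wqo_on (=) {f a}"
    unfolding wqo_on_def by (intro allI impI exI[of _ id]) (simp add: strict_mono_def)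
  ultimately show "\<exists>\<phi>::nat \<Rightarrow> nat. strict_mono \<phi> \<and> (\<forall>i j. i < j \<longrightarrow> f (\<phi> i) = f (\<phi> j))"
    using wqo_on_subsequence[of "(=)" "{f a}" f] by simp
qed

text \<open>Iterating the choice of a later, larger element orders neighbours; transitivity extends
  this to all pairs.\<close>

lemma increasing_chain_ex:
  fixes f :: "nat \<Rightarrow> 'a"
  assumes "\<And>i. \<exists>j>i. P (f i) (f j)" "transp P"
  shows "\<exists>\<phi>::nat \<Rightarrow> nat. strict_mono \<phi> \<and> (\<forall>i j. i < j \<longrightarrow> P (f (\<phi> i)) (f (\<phi> j)))"
proof -
  obtain s where s: "\<And>i. s i > i" "\<And>i. P (f i) (f (s i))"
    using assms(1) by metis
  define \<phi> where "\<phi> = rec_nat 0 (\<lambda>_. s)"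
  have "\<phi> i < \<phi> j \<and> P (f (\<phi> i)) (f (\<phi> j))" if "i < j" for i j
    using that
  proof (induct j)
    case (Suc j)
    have step: "\<phi> j < \<phi> (Suc j)" "P (f (\<phi> j)) (f (\<phi> (Suc j)))"
      using s by (simp_all add: \<phi>_def)
    show ?case
    proof (cases "i = j")
      case False
      with Suc have "\<phi> i < \<phi> j" "P (f (\<phi> i)) (f (\<phi> j))" by auto
      with step show ?thesis using transpD[OF assms(2)] by (blast intro: less_trans)
    qed (use step in simp)
  qed simp
  then show ?thesis by (intro exI[of _ \<phi>]) (simp add: strict_mono_def)
qed

text \<open>Higman's lemma for a finite alphabet. A word that avoids \<^term>\<open>a # w\<close> either avoids the
  letter \<^term>\<open>a\<close>, or splits at its first \<^term>\<open>a\<close> into a word over the smaller alphabet and a word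
  that avoids \<^term>\<open>w\<close>; and a sequence with an element \<^term>\<open>w\<close> that embeds into only finitely
  many others eventually avoids \<^term>\<open>w\<close>.\<close>

lemma wqo_on_avoiding:
  assumes "\<And>a. a \<in> A \<Longrightarrow> wqo_on subseq (lists (A - {a}))" "w \<in> lists A"
  shows "wqo_on subseq {v \<in> lists A. \<not> subseq w v}"
  using assms(2)
proof (induct w)
  case Nil
  show ?case by (simp add: wqo_on_def)
next
  case (Cons a w)
  let ?S = "lists (A - {a})" and ?T = "{v \<in> lists A. \<not> subseq w v}"
  let ?h = "\<lambda>(x, y). x @ a # y"
  have "wqo_on subseq (?h ` (?S \<times> ?T))"
    by (rule wqo_on_image[OF wqo_on_Times[OF assms(1)[OF Cons(1)] Cons(3)]])
      (auto intro: list_emb_append_mono)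
  then have "wqo_on subseq (?S \<union> ?h ` (?S \<times> ?T))"
    by (rule wqo_on_Un[OF assms(1)[OF Cons(1)]])
  moreover have "{v \<in> lists A. \<not> subseq (a # w) v} \<subseteq> ?S \<union> ?h ` (?S \<times> ?T)"
  proof
    fix v assume v: "v \<in> {v \<in> lists A. \<not> subseq (a # w) v}"
    show "v \<in> ?S \<union> ?h ` (?S \<times> ?T)"
    proof (cases "a \<in> set v")
      case False
      with v show ?thesis by auto
    next
      case True
      then obtain x y where xy: "v = x @ a # y" "a \<notin> set x"
        by (metis split_list_first)
      have "subseq (a # w) v" if "subseq w y"
        unfolding xy(1) by (rule list_emb_append2) (simp add: that)
      with v have "\<not> subseq w y" by auto
      with v xy have "(x, y) \<in> ?S \<times> ?T" by auto
      with xy(1) show ?thesis by (intro UnI2 image_eqI[of _ _ "(x, y)"]) auto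
    qed
  qed
  ultimately show ?case by (rule wqo_on_subset)
qed

lemma wqo_on_subseq_lists:
  assumes "finite A"
  shows "wqo_on subseq (lists A)"
  using assms
proof (induct A rule: finite_psubset_induct)
  case (psubset A)
  show ?case unfolding wqo_on_def
  proof (intro allI impI)
    fix f :: "nat \<Rightarrow> 'a list"
    assume f: "\<forall>i. f i \<in> lists A"
    show "\<exists>\<phi>::nat \<Rightarrow> nat. strict_mono \<phi> \<and> (\<forall>i j. i < j \<longrightarrow> subseq (f (\<phi> i)) (f (\<phi> j)))"
    proof (cases "\<forall>i. \<exists>j>i. subseq (f i) (f j)")
      case True
      then show ?thesis
        by (intro increasing_chain_ex) (auto intro: transpI subseq_order.order_trans)
    next
      case False
      then obtain i where i: "\<And>j. j > i \<Longrightarrow> \<not> subseq (f i) (f j)" by blast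
      \<comment> \<open>The induction hypothesis applies because removing a letter of
        \<open>A\<close> leaves a proper subset.\<close>
      have "wqo_on subseq {v \<in> lists A. \<not> subseq (f i) v}"
        using psubset(2) f by (intro wqo_on_avoiding) auto
      moreover have "{i<..} \<subseteq> {j. f j \<in> {v \<in> lists A. \<not> subseq (f i) v}}"
        using f i by auto
      then have "infinite {j. f j \<in> {v \<in> lists A. \<not> subseq (f i) v}}"
        using infinite_Ioi infinite_super by blast
      ultimately show ?thesis by (rule wqo_on_subsequence)
    qed
  qed
qed

text \<open>The number of queues is fixed by the instance, so an iterated product suffices for the
  list of queues.\<close>

lemma wqo_on_list_all2:
  assumes "wqo_on P A"
  shows "wqo_on (list_all2 P) {xs \<in> lists A. length xs = n}"
proof (induct n)
  case 0
  show ?case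
    unfolding wqo_on_def by (intro allI impI exI[of _ id]) (simp add: strict_mono_def)
next
  case (Suc n)
  let ?h = "\<lambda>(x, xs). x # xs"
  have "wqo_on (list_all2 P) (?h ` (A \<times> {xs \<in> lists A. length xs = n}))"
    by (rule wqo_on_image[OF wqo_on_Times[OF assms Suc]]) auto
  moreover have "{xs \<in> lists A. length xs = Suc n} \<subseteq> ?h ` (A \<times> {xs \<in> lists A. length xs = n})"
    by (auto simp: length_Suc_conv image_iff)
  ultimately show ?case by (rule wqo_on_subset)
qed

text \<open>Without such a basis one could forever pick elements that lie above none of the earlier
  picks, and an increasing subsequence of the picks refutes this.\<close>

lemma wqo_on_finite_basis:
  assumes "wqo_on P A" "\<And>x. P x x"
  shows "\<exists>B. finite B \<and> B \<subseteq> A \<and> (\<forall>x\<in>A. \<exists>b\<in>B. P b x)"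
proof (rule ccontr)
  assume no: "\<not> ?thesis"
  have "\<exists>f. \<forall>n::nat. f n \<in> A \<and> (\<forall>i<n. \<not> P (f i) (f n))"
  proof (rule dependent_wellorder_choice)
    fix n :: nat and f :: "nat \<Rightarrow> 'a"
    assume "\<And>i. i < n \<Longrightarrow> f i \<in> A \<and> (\<forall>j<i. \<not> P (f j) (f i))"
    then have "f ` {..<n} \<subseteq> A" by auto
    moreover have "finite (f ` {..<n})" by simp
    ultimately have "\<not> (\<forall>x\<in>A. \<exists>b\<in>f ` {..<n}. P b x)" using no by blast
    then show "\<exists>x. x \<in> A \<and> (\<forall>i<n. \<not> P (f i) x)" by auto
  qed auto
  then obtain f :: "nat \<Rightarrow> 'a" where f: "\<And>n. f n \<in> A" "\<And>n i. i < n \<Longrightarrow> \<not> P (f i) (f n)"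
    by blast
  obtain \<phi> :: "nat \<Rightarrow> nat" where "strict_mono \<phi>" "\<And>i j. i < j \<Longrightarrow> P (f (\<phi> i)) (f (\<phi> j))"
    by (rule wqo_onE[OF assms(1), of f, OF f(1)]) blast
  then show False using f(2)[of "\<phi> 0" "\<phi> 1"] by (simp add: strict_mono_def)
qed

section \<open>The queue system\<close>

type_synonym letter = "nat option list"
text \<open>An instance lists the number of tracks, the automata with the tracks that each one
  reads, and the constraints, with indices from 0. A configuration carries the automata and
  constraints as labels of its state sets and queues, so \<open>step\<close> needs no instance.
  Keeping sets of states leaves the choice of the letter as the only nondeterminism.\<close>

type_synonym inst = "nat \<times> (letter nfa \<times> nat list) list \<times> (nat \<times> nat) list"
type_synonym conf = "((letter nfa \<times> nat list) \<times> nat list) list \<times> ((nat \<times> nat) \<times> nat list) list"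

definition project :: "letter \<Rightarrow> nat list \<Rightarrow> letter" where
  "project a js = map (\<lambda>j. lookup None a j) js"

text \<open>The convolution of a subtuple may be shorter than that of the whole tuple; hence letters that
  project to \<^const>\<open>None\<close> only are skipped.\<close>

definition read_states :: "letter nfa \<Rightarrow> nat list \<Rightarrow> letter \<Rightarrow> nat list" where
  "read_states A S b = (if \<forall>x\<in>set b. x = None then S
     else map (\<lambda>t. snd (snd t)) (filter (\<lambda>t. fst (snd t) = b \<and> fst t \<in> set S) (nfa_trans A)))"

definition opt_word :: "nat option \<Rightarrow> nat list" where
  "opt_word x = (case x of None \<Rightarrow> [] | Some c \<Rightarrow> [c])"

definition pop :: "nat option \<Rightarrow> nat list \<Rightarrow> nat list" where
  "pop y v = (case y of None \<Rightarrow> v | Some b \<Rightarrow> (case v of [] \<Rightarrow> v | c # z \<Rightarrow> if c = b then z else v))"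

text \<open>Enqueueing precedes dequeueing, so letters at the same position may match each
  other.\<close>

definition read_queue :: "nat list \<Rightarrow> nat option \<Rightarrow> nat option \<Rightarrow> nat list" where
  "read_queue u x y = pop y (u @ opt_word x)"

definition step :: "conf \<Rightarrow> letter \<Rightarrow> conf" where
  "step C a =
    (map (\<lambda>(c, S). (c, read_states (fst c) S (project a (snd c)))) (fst C),
     map (\<lambda>(e, u). (e, read_queue u (lookup None a (fst e)) (lookup None a (snd e)))) (snd C))"

definition start :: "inst \<Rightarrow> conf" where
  "start I = (map (\<lambda>c. (c, nfa_init (fst c))) (fst (snd I)), map (\<lambda>e. (e, [])) (snd (snd I)))"

definition accepting :: "conf \<Rightarrow> bool" where
  "accepting C \<longleftrightarrow> (\<forall>p\<in>set (fst C). \<exists>q\<in>set (snd p). q \<in> set (nfa_final (fst (fst p))))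
     \<and> (\<forall>p\<in>set (snd C). snd p = [])"

definition letters :: "nat \<Rightarrow> nat \<Rightarrow> letter list" where
  "letters k m = List.n_lists m (None # map Some [0..<k])"

text \<open>The letter sequence need not be a convolution: a word may pause and resume. This is harmless,
  because deleting the pauses preserves the queue constraints, and the automata of regular
  relations accept nothing but convolutions.\<close>

definition accepted :: "nat \<Rightarrow> inst \<Rightarrow> bool" where
  "accepted k I \<longleftrightarrow> (\<exists>as. (\<forall>a\<in>set as. a \<in> set (letters k (fst I))) \<and> accepting (foldl step (start I) as))"

definition queue_le :: "(nat \<times> nat) \<times> nat list \<Rightarrow> (nat \<times> nat) \<times> nat list \<Rightarrow> bool" where
  "queue_le = (\<lambda>p q. fst p = fst q \<and> subseq (snd p) (snd q))"

definition conf_le :: "conf \<Rightarrow> conf \<Rightarrow> bool" where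
  "conf_le = (\<lambda>C D. fst C = fst D \<and> list_all2 queue_le (snd C) (snd D))"

text \<open>A finite inductive invariant: all quantifiers range over given lists, which makes the
  certificate checkable.\<close>

definition refutes :: "nat \<Rightarrow> inst \<Rightarrow> conf list \<Rightarrow> bool" where
  "refutes k I B \<longleftrightarrow> (\<exists>b\<in>set B. conf_le b (start I)) \<and>
     (\<forall>b\<in>set B. (\<forall>a\<in>set (letters k (fst I)). \<exists>b'\<in>set B. conf_le b' (step b a)) \<and> \<not> accepting b)"

section \<open>Monotonicity and certificates of emptiness\<close>

lemma conf_le_refl: "conf_le C C"
  by (simp add: conf_le_def queue_le_def list_all2_refl)

lemma conf_le_trans: "conf_le C D \<Longrightarrow> conf_le D E \<Longrightarrow> conf_le C E"
  using list_all2_trans[of queue_le queue_le queue_le "snd C" "snd D" "snd E"]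
  by (auto simp: conf_le_def queue_le_def intro: subseq_order.order_trans)

text \<open>The critical case removes a letter from the larger queue only. Then the smaller queue is
  empty or starts with a different letter, so it embeds without the removed one.\<close>

lemma pop_mono:
  assumes "subseq u v"
  shows "subseq (pop y u) (pop y v)"
proof (cases y)
  case (Some b)
  show ?thesis
  proof (cases u)
    case (Cons c z)
    then obtain d w where v: "v = d # w"
      using assms by (cases v) auto
    show ?thesis
      using assms Some Cons v
      by (auto simp: pop_def subseq_Cons2_iff split: if_splits dest: subseq_Cons')
  qed (simp add: pop_def Some)
qed (use assms in \<open>simp add: pop_def\<close>)

lemma step_mono: "conf_le C D \<Longrightarrow> conf_le (step C a) (step D a)"
  unfolding conf_le_def step_def fst_conv snd_conv list_all2_map1 list_all2_map2
  by (erule conjE, intro conjI, simp, erule list_all2_mono)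
    (auto simp: queue_le_def read_queue_def intro!: pop_mono list_emb_append_mono)

lemma accepting_antimono:
  assumes "conf_le C D" "accepting D"
  shows "accepting C"
proof -
  have "snd p = []" if p: "p \<in> set (snd C)" for p
  proof -
    obtain i where "i < length (snd C)" "snd C ! i = p"
      using p by (auto simp: in_set_conv_nth)
    then have "queue_le p (snd D ! i)" "snd D ! i \<in> set (snd D)"
      using assms(1) by (auto simp: conf_le_def list_all2_conv_all_nth)
    with assms(2) show ?thesis by (auto simp: accepting_def queue_le_def)
  qed
  with assms show ?thesis by (auto simp: accepting_def conf_le_def)
qed

lemma refutes_sound:
  assumes "refutes k I B"
  shows "\<not> accepted k I"
proof -
  have "\<exists>b\<in>set B. conf_le b (foldl step (start I) as)"
    if "\<forall>a\<in>set as. a \<in> set (letters k (fst I))" for as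
    using that
  proof (induct as rule: rev_induct)
    case Nil
    then show ?case using assms by (simp add: refutes_def)
  next
    case (snoc a as)
    then obtain b where b: "b \<in> set B" "conf_le b (foldl step (start I) as)" by auto
    then obtain b' where "b' \<in> set B" "conf_le b' (step b a)"
      using assms snoc(2) unfolding refutes_def by (meson in_set_conv_decomp)
    moreover have "conf_le (step b a) (foldl step (start I) (as @ [a]))"
      using step_mono[OF b(2)] by simp
    ultimately show ?case using conf_le_trans by blast
  qed
  then show ?thesis
    using assms accepting_antimono unfolding accepted_def refutes_def by blast
qed

text \<open>State sets are lists that may repeat entries, so bounding the entries would not give
  finitely many. Each list that arises is \<open>nfa_init\<close> or the image of a filtered
  \<open>nfa_trans\<close>, which explains the bound on the length.\<close>

definition states_bound :: "letter nfa \<times> nat list \<Rightarrow> nat list set" where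
  "states_bound c = {S. set S \<subseteq> set (nfa_init (fst c)) \<union> (\<lambda>t. snd (snd t)) ` set (nfa_trans (fst c))
     \<and> length S \<le> length (nfa_init (fst c)) + length (nfa_trans (fst c))}"

definition conf_space :: "nat \<Rightarrow> inst \<Rightarrow> conf set" where
  "conf_space k I =
     {xs \<in> lists (\<Union>c\<in>set (fst (snd I)). {c} \<times> states_bound c). length xs = length (fst (snd I))} \<times>
     {xs \<in> lists (set (snd (snd I)) \<times> lists {..<k}). length xs = length (snd (snd I))}"

lemma wqo_on_conf_space: "wqo_on conf_le (conf_space k I)"
proof -
  have "finite (states_bound c)" for c
    unfolding states_bound_def by (rule finite_lists_length_le) auto
  then have "finite (\<Union>c\<in>set (fst (snd I)). {c} \<times> states_bound c)" by auto
  from finite_lists_length_eq[OF this, of "length (fst (snd I))"]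
  have "finite {xs \<in> lists (\<Union>c\<in>set (fst (snd I)). {c} \<times> states_bound c). length xs = length (fst (snd I))}"
    by (simp add: lists_eq_set)
  note 1 = wqo_on_eq_finite[OF this]
  have "wqo_on queue_le (set (snd (snd I)) \<times> lists {..<k})"
    unfolding queue_le_def
    by (rule wqo_on_Times[OF wqo_on_eq_finite[OF List.finite_set] wqo_on_subseq_lists[OF finite_lessThan]])
  note 2 = wqo_on_list_all2[OF this, of "length (snd (snd I))"]
  show ?thesis
    using wqo_on_Times[OF 1 2] unfolding conf_space_def conf_le_def .
qed

lemma read_states_bound:
  "S \<in> states_bound c \<Longrightarrow> read_states (fst c) S b \<in> states_bound c"
  unfolding read_states_def states_bound_def
  using length_filter_le[of "\<lambda>t. fst (snd t) = b \<and> fst t \<in> set S" "nfa_trans (fst c)"]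
  by (auto intro: trans_le_add2)

lemma lookup_letters: "a \<in> set (letters k m) \<Longrightarrow> lookup None a i = Some c \<Longrightarrow> c < k"
  by (cases "i < length a") (force simp: letters_def set_n_lists dest: nth_mem, simp add: lookup_def)

lemma set_pop: "set (pop y v) \<subseteq> set v"
  by (auto simp: pop_def split: option.splits list.splits if_splits)

lemma step_conf_space:
  assumes "C \<in> conf_space k I" "a \<in> set (letters k (fst I))"
  shows "step C a \<in> conf_space k I"
proof -
  have *: "read_queue u (lookup None a i) y \<in> lists {..<k}" if "u \<in> lists {..<k}" for u i y
    using that set_pop[of y "u @ opt_word (lookup None a i)"] lookup_letters[OF assms(2), of i]
    by (fastforce simp: read_queue_def opt_word_def split: option.splits)
  have q: "(e, read_queue u (lookup None a (fst e)) (lookup None a (snd e))) \<in> set (snd (snd I)) \<times> lists {..<k}"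
    if "(e, u) \<in> set (snd C)" for e u
  proof -
    from that assms(1) have "e \<in> set (snd (snd I))" "u \<in> lists {..<k}"
      unfolding conf_space_def by (auto simp: mem_Times_iff)
    with * show ?thesis by blast
  qed
  have s: "(c, read_states (fst c) S (project a (snd c))) \<in> (\<Union>c\<in>set (fst (snd I)). {c} \<times> states_bound c)"
    if "(c, S) \<in> set (fst C)" for c S
    using that assms(1) read_states_bound[of S c] unfolding conf_space_def by (auto simp: mem_Times_iff)
  show ?thesis
    using assms(1) q s unfolding conf_space_def step_def in_lists_conv_set
    by (auto simp: mem_Times_iff in_lists_conv_set)
qed

lemma start_conf_space: "start I \<in> conf_space k I"
  by (auto simp: conf_space_def start_def states_bound_def)

text \<open>The basis is taken inside the reachable set rather than in \<open>conf_space\<close>: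
  its members are then reachable, hence not accepting, and their successors are reachable again and
  lie above some member.\<close>

lemma refutes_complete:
  assumes "\<not> accepted k I"
  shows "\<exists>B. refutes k I B"
proof -
  let ?ok = "\<lambda>as. \<forall>a\<in>set as. a \<in> set (letters k (fst I))"
  let ?R = "{foldl step (start I) as |as. ?ok as}"
  have "foldl step (start I) as \<in> conf_space k I" if "?ok as" for as
    using that by (induct as rule: rev_induct) (auto simp: start_conf_space step_conf_space)
  then have "wqo_on conf_le ?R"
    by (intro wqo_on_subset[OF wqo_on_conf_space]) auto
  from wqo_on_finite_basis[OF this conf_le_refl] obtain B0 where
    B0: "finite B0" "B0 \<subseteq> ?R" "\<forall>C\<in>?R. \<exists>b\<in>B0. conf_le b C" by (elim exE conjE)
  obtain B where B: "set B = B0" using finite_list[OF B0(1)] by blast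
  have "start I \<in> ?R" by (auto intro: exI[of _ "[]"])
  moreover have "step b a \<in> ?R" if b: "b \<in> ?R" and a: "a \<in> set (letters k (fst I))" for b a
  proof -
    obtain as where "b = foldl step (start I) as" "?ok as" using b by auto
    with a show ?thesis by (auto intro!: exI[of _ "as @ [a]"])
  qed
  moreover have "\<not> accepting b" if "b \<in> ?R" for b
    using that assms by (auto simp: accepted_def)
  ultimately have "refutes k I B"
    unfolding refutes_def B using B0(2,3) by (meson subsetD)
  then show ?thesis ..
qed

section \<open>Computability of the queue system\<close>

text \<open>Brings the pointwise comparison into a form built from bounded quantifiers and total
  look-ups.\<close>

lemma list_all2_lookup:
  "list_all2 P xs ys \<longleftrightarrow> length xs = length ys \<and> (\<forall>i<length xs. P (lookup d xs i) (lookup d ys i))"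
  by (auto simp: list_all2_conv_all_nth)

lemma computable_read_states:
  assumes "computable f" "computable g" "computable h"
  shows "computable (\<lambda>x. read_states (f x) (g x) (h x))"
  by (rule computable_comp3[of read_states, OF _ assms])
    (unfold read_states_def nfa_trans_def, intro computable_intros)

lemma computable_read_queue:
  assumes "computable f" "computable g" "computable h"
  shows "computable (\<lambda>x. read_queue (f x) (g x) (h x))"
  by (rule computable_comp3[of read_queue, OF _ assms])
    (unfold read_queue_def pop_def opt_word_def, intro computable_intros)

lemma computable_step:
  assumes "computable f" "computable g"
  shows "computable (\<lambda>x. step (f x) (g x))"
  by (rule computable_comp2[of step, OF _ assms])
    (unfold step_def project_def, intro computable_intros computable_read_states computable_read_queue)

lemma computable_start: "computable f \<Longrightarrow> computable (\<lambda>x. start (f x))"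
  by (rule computable_comp[of start]) (unfold start_def nfa_init_def, intro computable_intros)

lemma computable_letters: "computable f \<Longrightarrow> computable (\<lambda>x. letters k (f x))"
  unfolding letters_def by (intro computable_intros)

lemma decidable_accepting: "computable f \<Longrightarrow> decidable (\<lambda>x. accepting (f x))"
  by (rule decidable_comp[of accepting]) (unfold accepting_def nfa_final_def, intro computable_intros)

lemma decidable_conf_le:
  assumes "computable f" "computable g"
  shows "decidable (\<lambda>x. conf_le (f x) (g x))"
  by (rule decidable_comp2[of conf_le, OF _ assms])
    (unfold conf_le_def queue_le_def list_all2_lookup[where d = "((0, 0), [])"], intro computable_intros)

lemma decidable_accepted: "computable f \<Longrightarrow> decidable (\<lambda>x. accepted k (f x))"
proof (rule decidable_comp[of "accepted k"])
  show "decidable (accepted k)"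
  proof (rule decidable_complementary_searches)
    show "accepted k I \<longleftrightarrow> (\<exists>as. (\<forall>a\<in>set as. a \<in> set (letters k (fst I))) \<and>
        accepting (foldl step (start I) as))" for I
      by (rule accepted_def)
    show "\<not> accepted k I \<longleftrightarrow> (\<exists>B. refutes k I B)" for I
      using refutes_sound refutes_complete by blast
  qed (unfold refutes_def, (intro computable_intros computable_letters computable_start computable_step
      decidable_accepting decidable_conf_le)+)
qed

section \<open>Correctness of automata runs and greedy matching\<close>

definition track :: "letter list \<Rightarrow> nat \<Rightarrow> nat list" where
  "track as j = concat (map (\<lambda>a. opt_word (lookup None a j)) as)"

lemma track_simps [simp]:
  "track [] j = []" "track (a # as) j = opt_word (lookup None a j) @ track as j"
  by (simp_all add: track_def)

definition proper :: "letter \<Rightarrow> bool" where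
  "proper b \<longleftrightarrow> \<not> (\<forall>x\<in>set b. x = None)"

lemma foldl_step:
  "foldl step C as =
    (map (\<lambda>(c, S). (c, foldl (read_states (fst c)) S (map (\<lambda>a. project a (snd c)) as))) (fst C),
     map (\<lambda>(e, u). (e, foldl (\<lambda>u a. read_queue u (lookup None a (fst e)) (lookup None a (snd e))) u as)) (snd C))"
  by (induct as arbitrary: C) (simp_all add: step_def split_beta comp_def)

lemma nfa_run_Nil [simp]: "nfa_run A q [] q' \<longleftrightarrow> q = q'"
  by (auto intro: nfa_run.intros elim: nfa_run.cases)

lemma nfa_run_Cons [simp]:
  "nfa_run A q (a # w) q'' \<longleftrightarrow> (\<exists>q'. (q, a, q') \<in> set (nfa_trans A) \<and> nfa_run A q' w q'')"
  by (auto intro: nfa_run.intros elim: nfa_run.cases)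

text \<open>The subset construction, in which improper letters act as the identity.\<close>

lemma foldl_read_states:
  "q' \<in> set (foldl (read_states A) S bs) \<longleftrightarrow> (\<exists>q\<in>set S. nfa_run A q (filter proper bs) q')"
proof (induct bs arbitrary: S)
  case (Cons b bs)
  show ?case
  proof (cases "proper b")
    case True
    then have "set (read_states A S b) = {q'. \<exists>q\<in>set S. (q, b, q') \<in> set (nfa_trans A)}"
      by (force simp: read_states_def proper_def)
    with True show ?thesis by (auto simp: Cons)
  next
    case False
    then have "read_states A S b = S" by (auto simp: read_states_def proper_def)
    with False show ?thesis by (simp add: Cons)
  qed
qed auto

lemma accepting_foldl_step:
  "accepting (foldl step (start (m, cs, es)) as) \<longleftrightarrow>
    (\<forall>(A, js)\<in>set cs. filter proper (map (\<lambda>a. project a js) as) \<in> nfa_lang A) \<and>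
    (\<forall>(i, j)\<in>set es. foldl (\<lambda>u a. read_queue u (lookup None a i) (lookup None a j)) [] as = [])"
proof -
  have "(\<exists>q\<in>set (foldl (read_states A) (nfa_init A) bs). q \<in> set (nfa_final A))
      \<longleftrightarrow> filter proper bs \<in> nfa_lang A" for A bs
    unfolding Bex_def foldl_read_states nfa_lang_def by blast
  then show ?thesis
    unfolding accepting_def foldl_step start_def by (simp add: split_beta)
qed

text \<open>A letter that leaves the queue equals the letter \<open>y\<close> just read, so
  \<open>opt_word y\<close> pays for it.\<close>

lemma subseq_read_queue: "subseq (u @ opt_word x) (opt_word y @ read_queue u x y)"
  by (auto simp: read_queue_def pop_def opt_word_def split: option.splits list.splits)

text \<open>Soundness of matching for any letter sequence, pauses included: if the queue is empty at
  both ends, track \<open>i\<close> embeds into track \<open>j\<close>.\<close>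

lemma subseq_foldl_read_queue:
  "subseq (u @ track as i)
    (track as j @ foldl (\<lambda>u a. read_queue u (lookup None a i) (lookup None a j)) u as)"
proof (induct as arbitrary: u)
  case (Cons a as)
  let ?u = "read_queue u (lookup None a i) (lookup None a j)"
  have "subseq ((u @ opt_word (lookup None a i)) @ track as i)
     ((opt_word (lookup None a j) @ ?u) @ track as i)"
    by (intro list_emb_append_mono subseq_read_queue) simp
  also have "subseq \<dots> (opt_word (lookup None a j) @ track as j @
      foldl (\<lambda>u a. read_queue u (lookup None a i) (lookup None a j)) ?u as)"
    using Cons[of ?u] by (simp add: list_emb_append_mono)
  finally show ?case by simp
qed simp

fun padded :: "nat option list \<Rightarrow> bool" where
  "padded [] \<longleftrightarrow> True"
| "padded (x # xs) \<longleftrightarrow> (x = None \<longrightarrow> (\<forall>y\<in>set xs. y = None)) \<and> padded xs"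

text \<open>Greedy matching is optimal because no letter of the second word is wasted on an empty queue:
  the letter at the same position of the first word has already been enqueued.\<close>

lemma foldl_read_queue_empty:
  assumes "subseq (u @ track as i) (track as j)" "padded (map (\<lambda>a. lookup None a i) as)"
  shows "foldl (\<lambda>u a. read_queue u (lookup None a i) (lookup None a j)) u as = []"
  using assms
proof (induct as arbitrary: u)
  case Nil
  then show ?case by (auto elim: list_emb.cases)
next
  case (Cons a as)
  let ?v = "u @ opt_word (lookup None a i)" and ?y = "lookup None a j"
  have sub: "subseq (?v @ track as i) (opt_word ?y @ track as j)"
    using Cons(2) by simp
  have "subseq (pop ?y ?v @ track as i) (track as j)"
  proof (cases ?v)
    case Nil
    \<comment> \<open>The queue is empty even after enqueueing, so the first word pauses here; by
      padding it has ended, and there is nothing left to match.\<close>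
    then have "\<forall>a\<in>set as. lookup None a i = None"
      using Cons(3) by (auto simp: opt_word_def split: option.splits)
    then have "track as i = []" by (simp add: track_def opt_word_def)
    then show ?thesis by (simp add: Nil pop_def split: option.split)
  next
    case (Cons c z)
    from sub have "subseq (c # z @ track as i) (opt_word ?y @ track as j)"
      unfolding Cons by simp
    then show ?thesis unfolding Cons
      by (cases ?y) (auto simp: pop_def opt_word_def subseq_Cons2_iff)
  qed
  then show ?case using Cons(1)[of "pop ?y ?v"] Cons(3) by (simp add: read_queue_def)
qed

section \<open>Convolutions and their projections\<close>

definition width :: "nat list list \<Rightarrow> nat" where
  "width ws = foldr max (map length ws) 0"

lemma less_width_iff: "p < width ws \<longleftrightarrow> (\<exists>w\<in>set ws. p < length w)"
  by (induct ws) (auto simp: width_def less_max_iff_disj)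

lemma length_le_width: "w \<in> set ws \<Longrightarrow> length w \<le> width ws"
  by (induct ws) (auto simp: width_def)

definition symbol_at :: "nat list \<Rightarrow> nat \<Rightarrow> nat option" where
  "symbol_at w p = (if p < length w then Some (w ! p) else None)"

lemma conv_symbol_at: "conv ws = map (\<lambda>p. map (\<lambda>w. symbol_at w p) ws) [0..<width ws]"
  by (simp add: conv_def width_def symbol_at_def)

lemma map_symbol_at:
  assumes "length w \<le> n"
  shows "map (symbol_at w) [0..<n] = map Some w @ replicate (n - length w) None"
  using assms by (intro nth_equalityI) (auto simp: symbol_at_def nth_append)

lemma lookup_conv:
  assumes "j < length ws"
  shows "map (\<lambda>a. lookup None a j) (conv ws) = map Some (ws ! j) @ replicate (width ws - length (ws ! j)) None"
  using map_symbol_at[OF length_le_width[OF nth_mem[OF assms]]] assms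
  by (simp add: conv_symbol_at comp_def)

lemma padded_conv: "j < length ws \<Longrightarrow> padded (map (\<lambda>a. lookup None a j) (conv ws))"
proof -
  have "padded (replicate n None)" for n by (induct n) auto
  then have "padded (map Some w @ replicate n None)" for w n by (induct w) auto
  then show ?thesis if "j < length ws" using lookup_conv[OF that] by simp
qed

lemma track_conv: "j < length ws \<Longrightarrow> track (conv ws) j = ws ! j"
proof -
  have "concat (map opt_word (map Some w @ replicate n None)) = w" for w n
    by (induct w) (simp_all add: opt_word_def)
  moreover have "track (conv ws) j = concat (map opt_word (map (\<lambda>a. lookup None a j) (conv ws)))"
    by (simp add: track_def comp_def)
  ultimately show ?thesis if "j < length ws" using lookup_conv[OF that] by simp
qed

lemma filter_upt_less: "m \<le> n \<Longrightarrow> filter (\<lambda>p. p < m) [0..<n] = [0..<m]"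
  by (induct n) (auto simp: le_Suc_eq)

text \<open>A projected letter is improper exactly from the width of the subtuple on, so the filter
  only truncates and yields the shorter convolution.\<close>

lemma project_conv:
  assumes "\<forall>j\<in>set js. j < length ws"
  shows "filter proper (map (\<lambda>a. project a js) (conv ws)) = conv (map (\<lambda>j. ws ! j) js)"
proof -
  let ?vs = "map (\<lambda>j. ws ! j) js"
  have "map (\<lambda>a. project a js) (conv ws) = map (\<lambda>p. map (\<lambda>w. symbol_at w p) ?vs) [0..<width ws]"
    using assms by (auto simp: conv_symbol_at project_def)
  moreover have "proper (map (\<lambda>w. symbol_at w p) ?vs) \<longleftrightarrow> p < width ?vs" for p
    by (auto simp: less_width_iff symbol_at_def proper_def)
  moreover have "width ?vs \<le> width ws"
    using assms by (metis (no_types, lifting) image_iff less_width_iff linorder_not_le nth_mem order.irrefl set_map)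
  ultimately show ?thesis
    by (simp only: filter_map comp_def filter_upt_less conv_symbol_at)
qed

lemma lookup_improper: "\<not> proper b \<Longrightarrow> lookup None b t = None"
  by (cases "t < length b") (simp_all add: proper_def, simp add: lookup_def)

lemma track_filter: "track (filter proper bs) t = track bs t"
  by (induct bs) (auto simp: lookup_improper opt_word_def)

lemma track_project:
  "t < length js \<Longrightarrow> track (map (\<lambda>a. project a js) as) t = track as (js ! t)"
  by (induct as) (simp_all add: project_def)

lemma conv_letters:
  assumes "length ws = m" "\<forall>w\<in>set ws. sigma_word k w" "a \<in> set (conv ws)"
  shows "a \<in> set (letters k m)"
proof -
  obtain p where p: "a = map (\<lambda>w. symbol_at w p) ws"
    using assms(3) by (auto simp: conv_symbol_at)
  have "symbol_at w p \<in> insert None (Some ` {0..<k})" if "w \<in> set ws" for w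
    using assms(2) that by (fastforce simp: symbol_at_def sigma_word_def dest: nth_mem)
  with p assms(1) show ?thesis by (auto simp: letters_def set_n_lists)
qed

lemma accepted_iff:
  assumes cs: "\<And>A js. (A, js) \<in> set cs \<Longrightarrow> reg_nfa k (length js) A \<and> (\<forall>j\<in>set js. j < m)"
    and es: "\<And>i j. (i, j) \<in> set es \<Longrightarrow> i < m \<and> j < m"
  shows "accepted k (m, cs, es) \<longleftrightarrow> (\<exists>ws. length ws = m \<and> (\<forall>w\<in>set ws. sigma_word k w) \<and>
    (\<forall>(A, js)\<in>set cs. conv (map (\<lambda>j. ws ! j) js) \<in> nfa_lang A) \<and>
    (\<forall>(i, j)\<in>set es. subseq (ws ! i) (ws ! j)))" (is "?L \<longleftrightarrow> ?R")
proof
  assume ?R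
  then obtain ws where ws: "length ws = m" "\<forall>w\<in>set ws. sigma_word k w"
    "\<And>A js. (A, js) \<in> set cs \<Longrightarrow> conv (map (\<lambda>j. ws ! j) js) \<in> nfa_lang A"
    "\<And>i j. (i, j) \<in> set es \<Longrightarrow> subseq (ws ! i) (ws ! j)" by blast
  have "filter proper (map (\<lambda>a. project a js) (conv ws)) \<in> nfa_lang A" if "(A, js) \<in> set cs" for A js
    using cs[OF that] ws(3)[OF that] project_conv[of js ws] by (simp add: ws(1))
  moreover have "foldl (\<lambda>u a. read_queue u (lookup None a i) (lookup None a j)) [] (conv ws) = []"
    if "(i, j) \<in> set es" for i j
    using es[OF that] ws(4)[OF that]
    by (intro foldl_read_queue_empty padded_conv) (simp_all add: track_conv ws(1))
  ultimately have "accepting (foldl step (start (m, cs, es)) (conv ws))"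
    by (auto simp: accepting_foldl_step)
  moreover have "\<forall>a\<in>set (conv ws). a \<in> set (letters k m)"
    using conv_letters[OF ws(1,2)] by blast
  ultimately show ?L unfolding accepted_def by auto
next
  assume ?L
  then obtain as where as: "\<And>a. a \<in> set as \<Longrightarrow> a \<in> set (letters k m)"
    "\<And>A js. (A, js) \<in> set cs \<Longrightarrow> filter proper (map (\<lambda>a. project a js) as) \<in> nfa_lang A"
    "\<And>i j. (i, j) \<in> set es \<Longrightarrow> foldl (\<lambda>u a. read_queue u (lookup None a i) (lookup None a j)) [] as = []"
    unfolding accepted_def accepting_foldl_step fst_conv by blast
  let ?ws = "map (track as) [0..<m]"
  have "sigma_word k (track as j)" for j
    using lookup_letters[OF as(1), of _ j]
    by (fastforce simp: track_def sigma_word_def opt_word_def split: option.splits)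
  moreover have "conv (map (\<lambda>j. ?ws ! j) js) \<in> nfa_lang A" if c: "(A, js) \<in> set cs" for A js
  proof -
    let ?bs = "map (\<lambda>a. project a js) as"
    \<comment> \<open>As \<open>A\<close> accepts only convolutions, the word it reads is
      \<open>conv vs\<close>. Reading the tracks off both sides identifies \<open>vs\<close> with
      the selected tracks, although the tracks may contain pauses.\<close>
    from as(2)[OF c] cs[OF c] obtain vs where vs: "length vs = length js" "filter proper ?bs = conv vs"
      unfolding reg_nfa_def by blast
    have "?ws ! (js ! t) = vs ! t" if t: "t < length js" for t
    proof -
      have "vs ! t = track (filter proper ?bs) t"
        using t vs by (simp add: track_conv)
      also have "\<dots> = track as (js ! t)"
        using t by (simp add: track_filter track_project)
      finally show ?thesis using cs[OF c] t by simp
    qed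
    then have "map (\<lambda>j. ?ws ! j) js = vs"
      using vs(1) by (intro nth_equalityI) auto
    with as(2)[OF c] vs(2) show ?thesis by simp
  qed
  moreover have "subseq (?ws ! i) (?ws ! j)" if e: "(i, j) \<in> set es" for i j
    using subseq_foldl_read_queue[of "[]" as i j] as(3)[OF e] es[OF e] by simp
  ultimately show ?R by (intro exI[of _ ?ws]) auto
qed

section \<open>Reduction of the two decision problems\<close>

text \<open>A language becomes a unary regular relation, so path atoms can be treated as automata on
  a single track.\<close>

definition lift_nfa :: "nat nfa \<Rightarrow> letter nfa" where
  "lift_nfa A = (nfa_init A, nfa_final A, map (\<lambda>(q, c, q'). (q, [Some c], q')) (nfa_trans A))"

lemma conv_single: "conv [w] = map (\<lambda>c. [Some c]) w"
  by (rule nth_equalityI) (simp_all add: conv_def)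

lemma lift_nfa_simps [simp]:
  "nfa_init (lift_nfa A) = nfa_init A" "nfa_final (lift_nfa A) = nfa_final A"
  by (simp_all add: lift_nfa_def nfa_init_def nfa_final_def)

lemma lift_nfa_trans:
  "(q, b, q') \<in> set (nfa_trans (lift_nfa A)) \<longleftrightarrow> (\<exists>c. b = [Some c] \<and> (q, c, q') \<in> set (nfa_trans A))"
  by (force simp: lift_nfa_def nfa_trans_def)

lemma nfa_run_lift:
  "nfa_run (lift_nfa A) q bs q' \<longleftrightarrow> (\<exists>w. bs = conv [w] \<and> nfa_run A q w q')"
proof (induct bs arbitrary: q)
  case Nil
  then show ?case by (auto simp: conv_single)
next
  case (Cons b bs)
  have "nfa_run (lift_nfa A) q (b # bs) q' \<longleftrightarrow>
      (\<exists>c v. b # bs = conv [c # v] \<and> nfa_run A q (c # v) q')"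
    unfolding nfa_run_Cons lift_nfa_trans Cons conv_single by (simp only: list.map list.inject) blast
  also have "\<dots> \<longleftrightarrow> (\<exists>w. b # bs = conv [w] \<and> nfa_run A q w q')"
    by (metis conv_single list.distinct(1) list.exhaust list.simps(8))
  finally show ?case .
qed

lemma nfa_lang_lift: "bs \<in> nfa_lang (lift_nfa A) \<longleftrightarrow> (\<exists>w. bs = conv [w] \<and> w \<in> nfa_lang A)"
  unfolding nfa_lang_def mem_Collect_eq nfa_run_lift lift_nfa_simps by blast

lemma conv_single_eq_iff: "conv [w] = conv [v] \<longleftrightarrow> w = v"
  unfolding conv_single by (rule inj_map_eq_map) (simp add: inj_def)

lemma conv_single_in_lift: "conv [w] \<in> nfa_lang (lift_nfa A) \<longleftrightarrow> w \<in> nfa_lang A"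
  by (simp add: nfa_lang_lift conv_single_eq_iff)

lemma sigma_word_nfa_lang:
  assumes "sigma_nfa k A" "w \<in> nfa_lang A"
  shows "sigma_word k w"
proof -
  have "sigma_word k w" if "nfa_run A q w q'" for q q'
    using that assms(1) by (induct w arbitrary: q) (auto simp: sigma_word_def sigma_nfa_def)
  then show ?thesis using assms(2) by (auto simp: nfa_lang_def)
qed

lemma reg_nfa_lift:
  assumes "sigma_nfa k A"
  shows "reg_nfa k 1 (lift_nfa A)"
  unfolding reg_nfa_def
proof (intro conjI ballI)
  show "case t of (q, a, q') \<Rightarrow> length a = 1 \<and> (\<forall>x\<in>set a. x = None \<or> (\<exists>c<k. x = Some c))"
    if "t \<in> set (nfa_trans (lift_nfa A))" for t
    using that assms by (auto simp: lift_nfa_def nfa_trans_def sigma_nfa_def)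
  show "\<exists>ws. length ws = 1 \<and> (\<forall>v\<in>set ws. sigma_word k v) \<and> bs = conv ws"
    if bs: "bs \<in> nfa_lang (lift_nfa A)" for bs
  proof -
    obtain w where "bs = conv [w]" "w \<in> nfa_lang A" using bs by (auto simp: nfa_lang_lift)
    with sigma_word_nfa_lang[OF assms] show ?thesis by (intro exI[of _ "[w]"]) simp
  qed
qed

text \<open>The graph with a chosen source and target is itself an automaton, so a path condition is
  a language condition.\<close>

lemma gpath_iff: "gpath G u w v \<longleftrightarrow> w \<in> nfa_lang ([u], [v], snd G)"
proof -
  have "gpath G u w v \<longleftrightarrow> nfa_run ([u'], [v'], snd G) u w v" for u' v'
  proof
    show "gpath G u w v \<Longrightarrow> nfa_run ([u'], [v'], snd G) u w v"
      by (induct rule: gpath.induct) (auto simp: nfa_trans_def)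
    show "nfa_run ([u'], [v'], snd G) u w v \<Longrightarrow> gpath G u w v"
      by (induct rule: nfa_run.induct) (auto simp: nfa_trans_def intro: gpath.intros)
  qed
  then show ?thesis by (auto simp: nfa_lang_def nfa_init_def nfa_final_def)
qed

text \<open>The single automaton reads all tracks. Indices shift from 1-based to 0-based, and the
  range of \<open>I\<close> keeps the truncated \<open>i - 1\<close> below \<open>m\<close>.\<close>

lemma subword_inter_nonempty_iff:
  assumes "reg_nfa k m A" "set I \<subseteq> {1..m} \<times> {1..m}"
  shows "subword_inter_nonempty k m A I \<longleftrightarrow>
    accepted k (m, [(A, [0..<m])], map (\<lambda>(i, j). (i - 1, j - 1)) I)"
proof -
  have "map (\<lambda>j. ws ! j) [0..<m] = ws" if "length ws = m" for ws :: "nat list list"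
    using that map_nth by blast
  moreover have "i - 1 < m \<and> j - 1 < m" if "(i, j) \<in> set I" for i j
    using assms(2) that by fastforce
  ultimately show ?thesis
    by (subst accepted_iff)
      (use assms in \<open>auto simp: subword_inter_nonempty_def rel_of_def split_beta\<close>)
qed

section \<open>From queries to instances\<close>

type_synonym path_atom = "nat \<times> nat nfa \<times> nat"

text \<open>Each path atom owns one track and puts two automata on it, the graph between the chosen
  end nodes and the language. Default values keep the construction total and hence
  computable.\<close>

definition query_inst ::
  "(nat \<times> nat \<times> nat) list \<Rightarrow> nat list \<Rightarrow> path_atom list \<Rightarrow> (letter nfa \<times> nat list) list \<Rightarrow>
    (nat \<times> nat) list \<Rightarrow> inst" where
  "query_inst es \<nu> ps rs ss = (length ps,
     concat (map (\<lambda>i. case lookup (0, ([], [], []), 0) ps i of (x, L, y) \<Rightarrow>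
       [(lift_nfa ([lookup 0 \<nu> x], [lookup 0 \<nu> y], es), [i]), (lift_nfa L, [i])]) [0..<length ps]) @ rs,
     ss)"

text \<open>Graph, node tuple and query flattened into a tuple of coded types, since
  \<open>ecrpq\<close> itself carries no coding.\<close>

type_synonym eval_instance =
  "nat \<times> (nat \<times> nat \<times> nat) list \<times> nat list \<times> nat \<times> nat list \<times> path_atom list \<times>
     (letter nfa \<times> nat list) list \<times> (nat \<times> nat) list"

definition query_accepted :: "nat \<Rightarrow> eval_instance \<Rightarrow> bool" where
  "query_accepted k E = (case E of (N, es, vs, n, fs, ps, rs, ss) \<Rightarrow>
     \<exists>\<nu>\<in>set (List.n_lists n [0..<N]).
       (\<forall>i<length fs. lookup 0 \<nu> (lookup 0 fs i) = lookup 0 vs i) \<and>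
       accepted k (query_inst es \<nu> ps rs ss))"

lemma accepted_query_inst:
  assumes "\<And>u a v. (u, a, v) \<in> set (snd G) \<Longrightarrow> a < k" "wf_query k Q"
    and len: "length \<nu> = q_nvars Q"
  shows "accepted k (query_inst (snd G) \<nu> (q_patoms Q) (q_ratoms Q) (q_satoms Q)) \<longleftrightarrow>
    (\<exists>ws. length ws = length (q_patoms Q)
        \<and> (\<forall>i < length (q_patoms Q). case q_patoms Q ! i of (x, L, y) \<Rightarrow>
              gpath G (\<nu> ! x) (ws ! i) (\<nu> ! y) \<and> ws ! i \<in> nfa_lang L)
        \<and> (\<forall>(R, js) \<in> set (q_ratoms Q). conv (map (\<lambda>j. ws ! j) js) \<in> nfa_lang R)
        \<and> (\<forall>(i, j) \<in> set (q_satoms Q). subseq (ws ! i) (ws ! j)))"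
proof -
  let ?ps = "q_patoms Q" and ?rs = "q_ratoms Q" and ?ss = "q_satoms Q"
  let ?G = "\<lambda>x y. ([\<nu> ! x], [\<nu> ! y], snd G)"
  define ds where "ds = concat (map (\<lambda>i. case lookup (0, ([], [], []), 0) ?ps i of (x, L, y) \<Rightarrow>
       [(lift_nfa ([lookup 0 \<nu> x], [lookup 0 \<nu> y], snd G), [i]), (lift_nfa L, [i])]) [0..<length ?ps])"
  have p: "x < q_nvars Q" "y < q_nvars Q" "sigma_nfa k L"
    if "?ps ! i = (x, L, y)" "i < length ?ps" for i x L y
    using assms(2) nth_mem[OF that(2)] that(1) by (auto simp: wf_query_def)
  have g: "sigma_nfa k (?G x y)" for x y
    using assms(1) by (auto simp: sigma_nfa_def nfa_trans_def)
  define D where "D = (\<lambda>i. case ?ps ! i of (x, L, y) \<Rightarrow> [(lift_nfa (?G x y), [i]), (lift_nfa L, [i])])"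
  have "(case lookup (0, ([], [], []), 0) ?ps i of (x, L, y) \<Rightarrow>
      [(lift_nfa ([lookup 0 \<nu> x], [lookup 0 \<nu> y], snd G), [i]), (lift_nfa L, [i])]) = D i"
    if "i < length ?ps" for i
  proof -
    obtain x L y where i: "?ps ! i = (x, L, y)" by (rule prod_cases3)
    then show ?thesis using p(1,2)[OF i that] that len by (simp add: D_def)
  qed
  then have "ds = concat (map D [0..<length ?ps])"
    unfolding ds_def by (intro arg_cong[of _ _ concat] map_cong refl) simp
  then have "(A, js) \<in> set ds \<longleftrightarrow> (\<exists>i<length ?ps. (A, js) \<in> set (D i))" for A js
    by auto
  moreover have "(A, js) \<in> set (D i) \<longleftrightarrow> (\<exists>x L y. ?ps ! i = (x, L, y) \<and> js = [i] \<and>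
      (A = lift_nfa (?G x y) \<or> A = lift_nfa L))" for A js i
    by (cases "?ps ! i") (simp add: D_def; blast)
  ultimately have ds: "(A, js) \<in> set ds \<longleftrightarrow> (\<exists>i x L y. i < length ?ps \<and> ?ps ! i = (x, L, y) \<and> js = [i] \<and>
      (A = lift_nfa (?G x y) \<or> A = lift_nfa L))" for A js
    by blast
  have wf: "reg_nfa k (length js) A \<and> (\<forall>j\<in>set js. j < length ?ps)"
    if "(A, js) \<in> set (ds @ ?rs)" for A js
  proof (cases "(A, js) \<in> set ds")
    case True
    then show ?thesis using reg_nfa_lift[OF g] reg_nfa_lift[OF p(3)] by (auto simp: ds)
  next
    case False
    with that have "(A, js) \<in> set ?rs" by simp
    then show ?thesis using assms(2) by (auto simp: wf_query_def)
  qed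
  have wfs: "i < length ?ps \<and> j < length ?ps" if "(i, j) \<in> set ?ss" for i j
    using assms(2) that by (auto simp: wf_query_def)
  have paths: "(\<forall>(A, js)\<in>set ds. conv (map (\<lambda>j. ws ! j) js) \<in> nfa_lang A) \<longleftrightarrow>
    (\<forall>i < length ?ps. case ?ps ! i of (x, L, y) \<Rightarrow>
              gpath G (\<nu> ! x) (ws ! i) (\<nu> ! y) \<and> ws ! i \<in> nfa_lang L)" (is "?A \<longleftrightarrow> ?B") for ws
  proof -
    have "?A \<longleftrightarrow> (\<forall>i x L y. i < length ?ps \<and> ?ps ! i = (x, L, y) \<longrightarrow>
        conv [ws ! i] \<in> nfa_lang (lift_nfa (?G x y)) \<and> conv [ws ! i] \<in> nfa_lang (lift_nfa L))"
      (is "_ \<longleftrightarrow> ?C")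
    proof
      assume A: ?A
      show ?C
      proof (intro allI impI)
        fix i x L y
        assume "i < length ?ps \<and> ?ps ! i = (x, L, y)"
        then have "(lift_nfa (?G x y), [i]) \<in> set ds" "(lift_nfa L, [i]) \<in> set ds"
          unfolding ds by blast+
        from bspec[OF A this(1)] bspec[OF A this(2)]
        show "conv [ws ! i] \<in> nfa_lang (lift_nfa (?G x y)) \<and> conv [ws ! i] \<in> nfa_lang (lift_nfa L)"
          by simp
      qed
    next
      assume C: ?C
      show ?A
      proof (rule ballI)
        fix c assume c: "c \<in> set ds"
        obtain A js where [simp]: "c = (A, js)" by (rule prod.exhaust)
        from c obtain i x L y where "i < length ?ps" "?ps ! i = (x, L, y)" "js = [i]"
          "A = lift_nfa (?G x y) \<or> A = lift_nfa L"
          unfolding \<open>c = (A, js)\<close> ds by blast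
        with C[rule_format, of i x L y]
        show "case c of (A, js) \<Rightarrow> conv (map (\<lambda>j. ws ! j) js) \<in> nfa_lang A" by auto
      qed
    qed
    also have "\<dots> \<longleftrightarrow> ?B"
      unfolding conv_single_in_lift gpath_iff by (auto split: prod.splits)
    finally show ?thesis .
  qed
  \<comment> \<open>\<open>query_holds\<close> does not ask for words over the alphabet, whereas
    \<open>accepted_iff\<close> does. Every path variable labels a path of the graph, so its word
    uses only edge labels.\<close>
  have sigma: "sigma_word k w" if "\<forall>i < length ?ps. case ?ps ! i of (x, L, y) \<Rightarrow>
        gpath G (\<nu> ! x) (ws ! i) (\<nu> ! y) \<and> ws ! i \<in> nfa_lang L" "length ws = length ?ps" "w \<in> set ws" for w ws
  proof -
    obtain i where i: "i < length ?ps" "w = ws ! i"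
      using \<open>w \<in> set ws\<close> \<open>length ws = length ?ps\<close> by (metis in_set_conv_nth)
    obtain x L y where "?ps ! i = (x, L, y)" by (rule prod_cases3)
    with that(1) i have "w \<in> nfa_lang (?G x y)" by (auto simp: gpath_iff)
    then show ?thesis by (rule sigma_word_nfa_lang[OF g])
  qed
  have "query_inst (snd G) \<nu> ?ps ?rs ?ss = (length ?ps, ds @ ?rs, ?ss)"
    by (simp add: query_inst_def ds_def)
  then have "accepted k (query_inst (snd G) \<nu> ?ps ?rs ?ss) \<longleftrightarrow>
    (\<exists>ws. length ws = length ?ps \<and> (\<forall>w\<in>set ws. sigma_word k w) \<and>
      (\<forall>(A, js)\<in>set (ds @ ?rs). conv (map (\<lambda>j. ws ! j) js) \<in> nfa_lang A) \<and>
      (\<forall>(i, j)\<in>set ?ss. subseq (ws ! i) (ws ! j)))"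
    using accepted_iff[of "ds @ ?rs" k "length ?ps" ?ss, OF wf wfs] by (simp only:)
  then show ?thesis
    unfolding set_append ball_Un paths using sigma by blast
qed

lemma query_holds_iff:
  assumes "wf_graph k G" "wf_query k Q" "length vs = length (q_free Q)"
  shows "query_holds G vs Q \<longleftrightarrow>
    query_accepted k (fst G, snd G, vs, q_nvars Q, q_free Q, q_patoms Q, q_ratoms Q, q_satoms Q)"
    (is "_ \<longleftrightarrow> ?R")
proof -
  have G: "\<And>u a v. (u, a, v) \<in> set (snd G) \<Longrightarrow> a < k"
    using assms(1) by (auto simp: wf_graph_def)
  have free: "x < q_nvars Q" if "i < length (q_free Q)" "x = q_free Q ! i" for i x
    using assms(2) that by (auto simp: wf_query_def)
  have atom: "x < q_nvars Q \<and> y < q_nvars Q"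
    if "q_patoms Q ! i = (x, L, y)" "i < length (q_patoms Q)" for i x L y
    using assms(2) nth_mem[OF that(2)] that(1) by (auto simp: wf_query_def)
  let ?S = "\<lambda>\<nu> ws. length ws = length (q_patoms Q)
        \<and> (\<forall>i < length (q_patoms Q). case q_patoms Q ! i of (x, L, y) \<Rightarrow>
              gpath G (\<nu> x) (ws ! i) (\<nu> y) \<and> ws ! i \<in> nfa_lang L)
        \<and> (\<forall>(R, js) \<in> set (q_ratoms Q). conv (map (\<lambda>j. ws ! j) js) \<in> nfa_lang R)
        \<and> (\<forall>(i, j) \<in> set (q_satoms Q). subseq (ws ! i) (ws ! j))"
  have R: "?R \<longleftrightarrow> (\<exists>\<nu>. length \<nu> = q_nvars Q \<and> set \<nu> \<subseteq> {0..<fst G} \<and>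
      (\<forall>i<length (q_free Q). \<nu> ! (q_free Q ! i) = vs ! i) \<and> (\<exists>ws. ?S ((!) \<nu>) ws))"
    unfolding query_accepted_def
    using accepted_query_inst[OF G assms(2)] free assms(3)
    by (auto simp: set_n_lists cong: conj_cong)
  show ?thesis
  proof
    assume "query_holds G vs Q"
    then obtain \<nu> ws where \<nu>: "\<forall>x < q_nvars Q. \<nu> x < fst G"
      "\<forall>i < length (q_free Q). \<nu> (q_free Q ! i) = vs ! i" and ws: "?S \<nu> ws"
      unfolding query_holds_def by blast
    \<comment> \<open>Only the values on the node variables matter, so a finite list can replace the
      valuation.\<close>
    let ?\<nu> = "map \<nu> [0..<q_nvars Q]"
    have "?S ((!) ?\<nu>) ws"
      using ws atom by (fastforce split: prod.splits)
    with \<nu> free show ?R unfolding R by (intro exI[of _ ?\<nu>]) auto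
  next
    assume ?R
    then obtain \<nu> ws where \<nu>: "length \<nu> = q_nvars Q" "set \<nu> \<subseteq> {0..<fst G}"
      and S: "\<forall>i<length (q_free Q). \<nu> ! (q_free Q ! i) = vs ! i" "?S ((!) \<nu>) ws"
      unfolding R by blast
    have "\<nu> ! x < fst G" if "x < q_nvars Q" for x
      using subsetD[OF \<nu>(2) nth_mem[of x \<nu>]] \<nu>(1) that by simp
    with S show "query_holds G vs Q"
      unfolding query_holds_def by (intro exI[of _ "(!) \<nu>"] exI[of _ ws]) simp
  qed
qed

section \<open>Decoding the inputs\<close>

definition field :: "nat \<Rightarrow> nat \<Rightarrow> nat" where
  "field n i = lookup 0 (decode n) i"

text \<open>The prescribed encodings store tuples as coded lists, but \<open>code\<close> uses
  nested pairs; therefore tuples are rebuilt field by field.\<close>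

definition parse_nfa :: "nat \<Rightarrow> ('a::godel) nfa" where
  "parse_nfa n = (decode (field n 0), decode (field n 1),
     map (\<lambda>t. (field t 0, decode (field t 1), field t 2)) (decode (field n 2)))"

definition parse_instance :: "nat \<Rightarrow> inst" where
  "parse_instance n = (field n 0, [(parse_nfa (field n 1), [0..<field n 0])],
     map (\<lambda>(i, j). (i - 1, j - 1)) (decode (field n 2)))"

definition parse_eval_instance :: "nat \<Rightarrow> eval_instance" where
  "parse_eval_instance n =
    (field (field n 0) 0,
     map (\<lambda>t. (field t 0, field t 1, field t 2)) (decode (field (field n 0) 1)),
     decode (field n 1),
     field (field n 2) 0,
     decode (field (field n 2) 1),
     map (\<lambda>t. (field t 0, parse_nfa (field t 1), field t 2)) (decode (field (field n 2) 2)),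
     map (\<lambda>t. (parse_nfa (field t 0), decode (field t 1))) (decode (field (field n 2) 3)),
     decode (field (field n 2) 4))"

lemma code_nat_list: "code xs = list_encode xs" for xs :: "nat list"
  by (simp add: code_list_def map_idI)

lemma decode_list_encode [simp]: "decode (list_encode xs) = (xs :: nat list)"
  by (metis code_nat_list decode_code)

lemma decode_map_prod_encode [simp]: "decode (list_encode (map prod_encode es)) = es"
proof -
  have "prod_encode = code" by (auto simp: code_prod_def)
  then have "list_encode (map prod_encode es) = code es" by (simp add: code_list_def)
  then show ?thesis by simp
qed

lemma field_list_encode [simp]: "i < length xs \<Longrightarrow> field (list_encode xs) i = xs ! i"
  by (simp add: field_def)

lemma code_letter: "enc_tuple_letter = code"
proof -
  have "enc_opt = code" by (auto simp: enc_opt_def code_option_def split: option.split)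
  then show ?thesis by (auto simp: enc_tuple_letter_def code_list_def)
qed

lemma parse_enc_nfa: "parse_nfa (enc_nfa code A) = A"
  by (simp add: parse_nfa_def enc_nfa_def nfa_init_def nfa_final_def nfa_trans_def split_beta comp_def
      del: list_encode.simps)

lemma parse_enc_nfa_id: "parse_nfa (enc_nfa id A) = (A :: nat nfa)"
proof -
  have "id = (code :: nat \<Rightarrow> nat)" by auto
  then show ?thesis by (simp add: parse_enc_nfa)
qed

lemma parse_enc_instance:
  "parse_instance (enc_instance m A I) = (m, [(A, [0..<m])], map (\<lambda>(i, j). (i - 1, j - 1)) I)"
  by (simp add: parse_instance_def enc_instance_def code_letter parse_enc_nfa del: list_encode.simps)

lemma parse_enc_eval_instance:
  "parse_eval_instance (enc_eval_instance G vs Q) =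
    (fst G, snd G, vs, q_nvars Q, q_free Q, q_patoms Q, q_ratoms Q, q_satoms Q)"
  by (simp add: parse_eval_instance_def enc_eval_instance_def enc_graph_def enc_query_def
      code_letter parse_enc_nfa parse_enc_nfa_id split_beta comp_def nth_Cons_numeral
      del: list_encode.simps)

lemma computable_field: "computable f \<Longrightarrow> computable g \<Longrightarrow> computable (\<lambda>x. field (f x) (g x))"
  unfolding field_def by (intro computable_intros)

lemma computable_parse_nfa: "computable f \<Longrightarrow> computable (\<lambda>x. parse_nfa (f x))"
  by (rule computable_comp[of parse_nfa])
    (unfold parse_nfa_def, intro computable_intros computable_field)

lemma computable_parse_instance: "computable parse_instance"
  unfolding parse_instance_def[abs_def]
  by (intro computable_intros computable_field computable_parse_nfa)

lemma computable_parse_eval_instance: "computable parse_eval_instance"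
  unfolding parse_eval_instance_def[abs_def]
  by (intro computable_intros computable_field computable_parse_nfa)

lemma computable_lift_nfa: "computable f \<Longrightarrow> computable (\<lambda>x. lift_nfa (f x))"
  by (rule computable_comp[of lift_nfa])
    (unfold lift_nfa_def nfa_init_def nfa_final_def nfa_trans_def, intro computable_intros)

lemma decidable_query_accepted: "decidable (query_accepted k)"
  unfolding query_accepted_def[abs_def] query_inst_def
  by (intro computable_intros decidable_accepted computable_lift_nfa)

theorem mainTheorem13:
  fixes k :: nat
  shows "(\<exists>f. \<forall>m A I. 1 \<le> m \<and> reg_nfa k m A \<and> set I \<subseteq> {1..m} \<times> {1..m} \<longrightarrow>
             eval f [enc_instance m A I] (if subword_inter_nonempty k m A I then 1 else 0))
       \<and> (\<exists>g. \<forall>G vs Q. wf_graph k G \<and> wf_query k Q \<and> length vs = length (q_free Q)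
                       \<and> (\<forall>v \<in> set vs. v < fst G) \<longrightarrow>
             eval g [enc_eval_instance G vs Q] (if query_holds G vs Q then 1 else 0))"
proof (intro conjI)
  \<comment> \<open>This machine answers on every number; the conditions on the input serve only to
    identify its answer with \<open>subword_inter_nonempty\<close>.\<close>
  obtain f where f: "\<And>n. eval f [code n] (if accepted k (parse_instance n) then 1 else 0)"
    using decidable_eval[OF decidable_accepted[OF computable_parse_instance]] by blast
  show "\<exists>f. \<forall>m A I. 1 \<le> m \<and> reg_nfa k m A \<and> set I \<subseteq> {1..m} \<times> {1..m} \<longrightarrow>
      eval f [enc_instance m A I] (if subword_inter_nonempty k m A I then 1 else 0)"
  proof (intro exI allI impI)
    fix m A I
    assume "1 \<le> m \<and> reg_nfa k m A \<and> set I \<subseteq> {1..m} \<times> {1..m}"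
    then show "eval f [enc_instance m A I] (if subword_inter_nonempty k m A I then 1 else 0)"
      using f[of "enc_instance m A I"]
      by (simp only: code_nat_def subword_inter_nonempty_iff parse_enc_instance)
  qed
  obtain g where g: "\<And>n. eval g [code n] (if query_accepted k (parse_eval_instance n) then 1 else 0)"
    using decidable_eval[OF decidable_comp[OF decidable_query_accepted computable_parse_eval_instance]]
    by blast
  show "\<exists>g. \<forall>G vs Q. wf_graph k G \<and> wf_query k Q \<and> length vs = length (q_free Q)
        \<and> (\<forall>v \<in> set vs. v < fst G) \<longrightarrow>
      eval g [enc_eval_instance G vs Q] (if query_holds G vs Q then 1 else 0)"
  proof (intro exI allI impI)
    fix G vs Q
    assume "wf_graph k G \<and> wf_query k Q \<and> length vs = length (q_free Q) \<and> (\<forall>v \<in> set vs. v < fst G)"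
    then show "eval g [enc_eval_instance G vs Q] (if query_holds G vs Q then 1 else 0)"
      using g[of "enc_eval_instance G vs Q"] query_holds_iff[of k G Q vs]
      by (simp only: code_nat_def parse_enc_eval_instance)
  qed
qed

end
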